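(* Let $\varepsilon>0$. There exists $\beta>0$ such that the following holds. Let $p$ be prime, let $a\in\mathbb{Z}_p^*$ have multiplicative order $q$ where $q<p^{1-\varepsilon}$, and let $b,b'\in\mathbb{Z}_p$ be any two elements. Let $P_b(v)$ be the probability of observing the basis vector $v$ in the Fourier basis of the affine group $A_p$ when the hidden subgroup is $H_a^b$, where the $(p-1)$-dimensional irreducible representation $\rho$ of $A_p$ is measured in a uniformly random orthonormal basis. Then with high probability over the random basis (probability tending to $1$ as $p\to\infty$), $$\sum_v \left|P_b(v)-P_{b'}(v)\right| < p^{-\beta}.$$ Thus it takes a number of measurements exponentially large in $\log p$ to distinguish the conjugates $H_a^b$ and $H_a^{b'}$.
   Context: $A_p$ is the set of pairs $(\alpha,\gamma)\in\mathbb{Z}_p^*\times\mathbb{Z}_p$ with multiplication $(\alpha_1,\gamma_1)(\alpha_2,\gamma_2)=(\alpha_1\alpha_2,\ \gamma_1+\alpha_1\gamma_2)$. $H_a=\langle(a,0)\rangle$ and $H_a^b=(1,b)H_a(1,-b)=\{(a^t,(1-a^t)b):t\in\mathbb{Z}\}$, a subgroup of order $q$. Irreducible representations of $A_p$: $p-1$ one-dimensional ones $\sigma_t$, $t \in \mathbb{Z}_{p-1}$, which are the characters of $\mathbb{Z}_p^*$ composed with $(\alpha,\gamma)\mapsto\alpha$; and one of dimension $p-1$, $\rho$, given by $\rho((\alpha,\gamma))_{j,k}=\omega_p^{\gamma j}$ if $k=\alpha j \bmod p$ and $0$ otherwise, for $1\le j,k<p$, where $\omega_p=e^{2\pi i/p}$.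 For a subgroup $H$ and an irreducible representation $\tau$ of dimension $d_\tau$, let $\pi_H(\tau)=\frac1{|H|}\sum_{h\in H}\tau(h)$, an orthogonal projection. The Fourier transform at $\tau$ of the uniform superposition on a left coset $cH$ is the matrix $\sqrt{d_\tau|H|/|G|}\;\tau(c)\pi_H(\tau)$, where $G=A_p$. Choosing an orthonormal basis $B_\tau$ of $\mathbb{C}^{d_\tau}$ for each $\tau$, Fourier sampling observes $v\in B_\tau$ with probability $\frac{d_\tau|H|}{|G|}\|\pi_H(\tau)v\|^2$ (independently of $c$). So for $H=H_a^b$: $P_b(v)=\frac{q}{p}\|\pi_{H_a^b}(\rho)v\|^2$ for $v\in B_\rho$, and $P_b(v)=\frac{q}{p(p-1)}\|\pi_{H_a^b}(\sigma_t)v\|^2$ for $v$ the unit basis vector of $\sigma_t$. The sum in the claim is over all $v$ in all the bases, and $B_\rho$ is Haar-random (the columns of a Haar-random unitary matrix in $U(p-1)$). *)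

theory Defs
  imports
    "HOL-Probability.Probability"
    "HOL-Number_Theory.Number_Theory"
    "HOL-Algebra.Generated_Groups"
    "Jordan_Normal_Form.Schur_Decomposition"
begin

hide_const (open) Finite_Cartesian_Product.vec Finite_Cartesian_Product.mat
no_notation Finite_Cartesian_Product.vec_nth (infixl \<open>$\<close> 90)

text \<open>Residues modulo \<open>p\<close> are represented by the naturals below \<open>p\<close>; for a prime \<open>p\<close>
  the group of units is \<open>{1..<p}\<close>.\<close>

definition affine_group :: "nat \<Rightarrow> (nat \<times> nat) monoid" where
  "affine_group p =
     \<lparr>carrier = {1..<p} \<times> {..<p},
      monoid.mult = (\<lambda>(\<alpha>1, \<gamma>1) (\<alpha>2, \<gamma>2). (\<alpha>1 * \<alpha>2 mod p, (\<gamma>1 + \<alpha>1 * \<gamma>2) mod p)),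
      one = (1, 0)\<rparr>"

definition base_subgroup :: "nat \<Rightarrow> nat \<Rightarrow> (nat \<times> nat) set" where
  "base_subgroup p a = generate (affine_group p) {(a, 0)}"

text \<open>For \<open>b < p\<close> the element \<open>(1, -b)\<close> is represented by \<open>(1, (p - b) mod p)\<close>.\<close>

definition conj_subgroup :: "nat \<Rightarrow> nat \<Rightarrow> nat \<Rightarrow> (nat \<times> nat) set" where
  "conj_subgroup p a b =
     (\<lambda>h. (1, b) \<otimes>\<^bsub>affine_group p\<^esub> h \<otimes>\<^bsub>affine_group p\<^esub> (1, (p - b) mod p)) ` base_subgroup p a"

text \<open>Characters of the unit group are taken extensional, so that each of them is represented
  by exactly one function.\<close>

definition unit_chars :: "nat \<Rightarrow> (nat \<Rightarrow> complex) set" where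
  "unit_chars p = {\<psi> \<in> extensional {1..<p}.
     (\<forall>x\<in>{1..<p}. \<psi> x \<noteq> 0) \<and>
     (\<forall>x\<in>{1..<p}. \<forall>y\<in>{1..<p}. \<psi> (x * y mod p) = \<psi> x * \<psi> y)}"

lemma finite_unit_chars:
  assumes P: "prime p"
  shows "finite (unit_chars p)"
proof -
  have p: "p > 1" using P prime_gt_1_nat by blast
  have root: "\<psi> x ^ (p - 1) = 1" if c: "\<psi> \<in> unit_chars p" and x: "x \<in> {1..<p}" for \<psi> x
  proof -
    have nd: "\<not> p dvd x" using x by (auto dest: dvd_imp_le)
    have pw: "\<psi> (x ^ Suc k mod p) = \<psi> x ^ Suc k" for k
    proof (induction k)
      case 0 then show ?case using x by auto
    next
      case (Suc k)
      have "\<not> p dvd x ^ Suc k" using P nd prime_dvd_power by blast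
      hence m: "x ^ Suc k mod p \<in> {1..<p}" using p by (simp add: dvd_eq_mod_eq_0 Suc_le_eq)
      have "x ^ Suc (Suc k) mod p = x * (x ^ Suc k mod p) mod p" by (simp add: mod_mult_right_eq)
      moreover have "\<psi> (x * (x ^ Suc k mod p) mod p) = \<psi> x * \<psi> (x ^ Suc k mod p)"
        using c m x unfolding unit_chars_def by blast
      ultimately show ?case using Suc.IH by simp
    qed
    have o: "(1::nat) \<in> {1..<p}" using p by simp
    have "\<psi> (1 * 1 mod p) = \<psi> 1 * \<psi> 1" "\<psi> 1 \<noteq> 0" using c o unfolding unit_chars_def by blast+
    hence one: "\<psi> 1 = 1" using p by simp
    have "x ^ (p - 1) mod p = 1" using fermat_theorem[OF P nd] p by (simp add: cong_def)
    thus ?thesis using pw[of "p - 2"] p one by (simp add: Suc_diff_Suc numeral_2_eq_2 del: power_Suc)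
  qed
  have "unit_chars p \<subseteq> {1..<p} \<rightarrow>\<^sub>E {z. z ^ (p - 1) = 1}"
    using root by (auto simp: PiE_def unit_chars_def)
  moreover have "finite {z :: complex. z ^ (p - 1) = 1}" using p by (intro finite_roots_unity) simp
  ultimately show ?thesis by (meson finite_PiE finite_atLeastLessThan finite_subset)
qed

definition char_rep :: "(nat \<Rightarrow> complex) \<Rightarrow> nat \<times> nat \<Rightarrow> complex mat" where
  "char_rep \<psi> = (\<lambda>(\<alpha>, \<gamma>). mat 1 1 (\<lambda>_. \<psi> \<alpha>))"

text \<open>Matrix indices start at \<open>0\<close>: position \<open>(j, k)\<close> holds the entry usually indexed by
  \<open>(j + 1, k + 1)\<close> with \<open>1 \<le> j + 1, k + 1 < p\<close>.\<close>

definition rho :: "nat \<Rightarrow> nat \<times> nat \<Rightarrow> complex mat" where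
  "rho p = (\<lambda>(\<alpha>, \<gamma>). mat (p - 1) (p - 1) (\<lambda>(j, k).
     if k + 1 = \<alpha> * (j + 1) mod p
     then exp (2 * of_real pi * \<i> / of_nat p) ^ (\<gamma> * (j + 1)) else 0))"

definition rep_average :: "nat \<Rightarrow> 'g set \<Rightarrow> ('g \<Rightarrow> complex mat) \<Rightarrow> complex mat" where
  "rep_average d H \<tau> = mat d d (\<lambda>ij. (\<Sum>h\<in>H. \<tau> h $$ ij) / of_nat (card H))"

definition vec_norm2 :: "complex vec \<Rightarrow> real" where
  "vec_norm2 v = (\<Sum>i<dim_vec v. (cmod (v $ i))\<^sup>2)"

definition fourier_prob ::
    "('g, 'x) monoid_scheme \<Rightarrow> 'g set \<Rightarrow> nat \<Rightarrow> ('g \<Rightarrow> complex mat) \<Rightarrow> complex vec \<Rightarrow> real" where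
  "fourier_prob G H d \<tau> v =
     real d * real (card H) / real (order G) * vec_norm2 (rep_average d H \<tau> *\<^sub>v v)"

text \<open>An outcome of Fourier sampling is an irreducible representation together with a vector of
  the orthonormal basis chosen for it. A one-dimensional representation has a single basis vector;
  the basis for \<^const>\<open>rho\<close> consists of the columns of a unitary matrix \<open>U\<close> and is indexed by
  the column number.\<close>

datatype outcome = Char_outcome "nat \<Rightarrow> complex" | Rho_outcome nat

definition outcomes :: "nat \<Rightarrow> outcome set" where
  "outcomes p = Char_outcome ` unit_chars p \<union> Rho_outcome ` {..<p - 1}"

fun outcome_prob :: "nat \<Rightarrow> nat \<Rightarrow> complex mat \<Rightarrow> nat \<Rightarrow> outcome \<Rightarrow> real" where
  "outcome_prob p a U b (Char_outcome \<psi>) =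
     fourier_prob (affine_group p) (conj_subgroup p a b) 1 (char_rep \<psi>) (unit_vec 1 0)"
| "outcome_prob p a U b (Rho_outcome k) =
     fourier_prob (affine_group p) (conj_subgroup p a b) (p - 1) (rho p) (col U k)"

definition unitary_mats :: "nat \<Rightarrow> complex mat set" where
  "unitary_mats n =
     {U \<in> carrier_mat n n. mat_adjoint U * U = 1\<^sub>m n \<and> U * mat_adjoint U = 1\<^sub>m n}"

text \<open>The Borel sets of the unitary group, as a subspace of the \<open>n \<times> n\<close> matrices.\<close>

definition borel_unitary :: "nat \<Rightarrow> complex mat measure" where
  "borel_unitary n =
     vimage_algebra (unitary_mats n) (\<lambda>U. \<lambda>ij\<in>{..<n} \<times> {..<n}. U $$ ij)
       (\<Pi>\<^sub>M ij\<in>{..<n} \<times> {..<n}. borel)"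

text \<open>The unitary group is compact, so exactly one measure satisfies the following.\<close>

definition haar_unitary :: "nat \<Rightarrow> complex mat measure \<Rightarrow> bool" where
  "haar_unitary n \<mu> \<longleftrightarrow> prob_space \<mu> \<and> sets \<mu> = sets (borel_unitary n) \<and>
     (\<forall>V\<in>unitary_mats n. distr \<mu> \<mu> (\<lambda>U. V * U) = \<mu>)"

text \<open>The probability that a randomised test accepts on \<open>m\<close> independent samples from a
  distribution \<open>P\<close> on a finite set \<open>\<Omega>\<close>, where \<open>f s\<close> is the probability of accepting the samples
  \<open>s 0, \<dots>, s (m - 1)\<close>.\<close>

definition accept_prob :: "'o set \<Rightarrow> ('o \<Rightarrow> real) \<Rightarrow> nat \<Rightarrow> ((nat \<Rightarrow> 'o) \<Rightarrow> real) \<Rightarrow> real" where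
  "accept_prob \<Omega> P m f = (\<Sum>s\<in>{..<m} \<rightarrow>\<^sub>E \<Omega>. (\<Prod>i<m. P (s i)) * f s)"

definition distinguishable ::
    "'o set \<Rightarrow> ('o \<Rightarrow> real) \<Rightarrow> ('o \<Rightarrow> real) \<Rightarrow> nat \<Rightarrow> real \<Rightarrow> bool" where
  "distinguishable \<Omega> P P' m \<delta> \<longleftrightarrow>
     (\<exists>f. (\<forall>s. 0 \<le> f s \<and> f s \<le> 1) \<and> \<bar>accept_prob \<Omega> P m f - accept_prob \<Omega> P' m f\<bar> \<ge> \<delta>)"

end

theory Submission
  imports Defs "HOL-Algebra.Multiplicative_Group"
begin

text \<open>
  Write \<open>\<Pi>\<^sub>b\<close> for the projection \<open>\<pi>\<^sub>H(\<rho>)\<close> with \<open>H = H\<^sub>a\<^sup>b\<close>, and \<open>n = p - 1\<close>. Its \<open>(j, l)\<close> entry is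
  \<open>\<omega>^(b (j - l)) / q\<close> if \<open>j\<close> and \<open>l\<close> lie in the same coset of the group generated by \<open>a\<close>, and \<open>0\<close>
  otherwise. Hence \<open>A = \<Pi>\<^sub>b - \<Pi>\<^sub>b\<^sub>'\<close> has zero diagonal and at most \<open>n q\<close> nonzero entries, each of
  modulus at most \<open>2 / q\<close>. For a column \<open>u\<close> of a Haar-random unitary matrix, invariance under monomial
  matrices alone makes the products \<open>cnj u\<^sub>j u\<^sub>l\<close> with \<open>j \<noteq> l\<close> pairwise orthogonal in \<open>L\<^sup>2\<close>, of squared
  norm at most \<open>1 / (n (n - 1))\<close>. So the second moment of the quadratic form of \<open>A\<close> at \<open>u\<close> is at most
  \<open>4 / (q (n - 1))\<close>, and by Cauchy-Schwarz over the columns the total variation has second moment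
  \<open>O(q / p)\<close>; Chebyshev's inequality then gives the first claim with \<open>\<beta> = \<epsilon> / 4\<close>. The one-dimensional
  representations contribute nothing, as they do not see \<open>b\<close>. The bound on the number of samples
  follows because the total variation of product distributions is subadditive.
\<close>

section \<open>Column moments of Haar-random unitary matrices\<close>

lemma dim_mat_adjoint [simp]:
  "dim_row (mat_adjoint A) = dim_col A" "dim_col (mat_adjoint A) = dim_row A"
  by (simp_all add: mat_adjoint_def)

lemma index_mat_adjoint [simp]:
  fixes A :: "complex mat"
  assumes "i < dim_col A" "j < dim_row A"
  shows "mat_adjoint A $$ (i, j) = cnj (A $$ (j, i))"
  using assms by (simp add: mat_adjoint_def mat_of_rows_index)

text \<open>The column relations normalise each basis vector; the row relations are the completeness
  relation behind the sum over a whole basis in \<open>sum_outcome_prob_rho\<close>.\<close>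

lemma unitary_mats_iff:
  "U \<in> unitary_mats n \<longleftrightarrow> U \<in> carrier_mat n n \<and>
     (\<forall>i<n. \<forall>j<n. (\<Sum>k<n. cnj (U $$ (k, i)) * U $$ (k, j)) = of_bool (i = j)) \<and>
     (\<forall>i<n. \<forall>j<n. (\<Sum>k<n. U $$ (i, k) * cnj (U $$ (j, k))) = of_bool (i = j))"
  (is "_ \<longleftrightarrow> ?R")
proof (cases "U \<in> carrier_mat n n")
  case True
  then have "mat_adjoint U * U = 1\<^sub>m n \<longleftrightarrow>
      (\<forall>i<n. \<forall>j<n. (\<Sum>k<n. cnj (U $$ (k, i)) * U $$ (k, j)) = of_bool (i = j))"
    by (subst mat_eq_iff) (auto simp: scalar_prod_def lessThan_atLeast0 of_bool_def)
  moreover from True have "U * mat_adjoint U = 1\<^sub>m n \<longleftrightarrow>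
      (\<forall>i<n. \<forall>j<n. (\<Sum>k<n. U $$ (i, k) * cnj (U $$ (j, k))) = of_bool (i = j))"
    by (subst mat_eq_iff) (auto simp: scalar_prod_def lessThan_atLeast0 of_bool_def)
  ultimately show ?thesis using True by (simp add: unitary_mats_def)
qed (simp add: unitary_mats_def)

lemma unitary_col_norm:
  assumes "U \<in> unitary_mats n" "k < n"
  shows "(\<Sum>i<n. (cmod (U $$ (i, k)))\<^sup>2) = 1"
proof -
  have "complex_of_real (\<Sum>i<n. (cmod (U $$ (i, k)))\<^sup>2) = (\<Sum>i<n. cnj (U $$ (i, k)) * U $$ (i, k))"
    by (simp add: complex_norm_square mult.commute del: of_real_power)
  also have "\<dots> = of_real 1"
    using assms by (simp add: unitary_mats_iff)
  finally show ?thesis unfolding of_real_eq_iff .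
qed

lemma unitary_entry_le_1:
  assumes "U \<in> unitary_mats n" "i < n" "k < n"
  shows "cmod (U $$ (i, k)) \<le> 1"
proof -
  have "(cmod (U $$ (i, k)))\<^sup>2 \<le> (\<Sum>i<n. (cmod (U $$ (i, k)))\<^sup>2)"
    using assms by (intro member_le_sum) auto
  then show ?thesis using unitary_col_norm[OF assms(1,3)] by (simp add: abs_square_le_1)
qed

text \<open>Left multiplication by this matrix turns row \<open>i\<close> into \<open>z i\<close>
  times row \<open>\<pi> i\<close>. Permuting rows and changing their phases are the only Haar
  symmetries that the moment bounds use.\<close>

definition monomial_mat :: "nat \<Rightarrow> (nat \<Rightarrow> nat) \<Rightarrow> (nat \<Rightarrow> complex) \<Rightarrow> complex mat" where
  "monomial_mat n \<pi> z = mat n n (\<lambda>(i, j). if j = \<pi> i then z i else 0)"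

lemma monomial_mat_unitary:
  assumes \<pi>: "\<pi> permutes {..<n}" and z: "\<And>i. cmod (z i) = 1"
  shows "monomial_mat n \<pi> z \<in> unitary_mats n"
proof -
  have z': "z i * cnj (z i) = 1" "cnj (z i) * z i = 1" for i
    using z[of i] complex_norm_square[of "z i"] by (simp_all add: mult.commute)
  define \<pi>' where "\<pi>' = inv_into UNIV \<pi>"
  have inv: "k = \<pi>' i \<longleftrightarrow> i = \<pi> k" for i k
    using permutes_inv_eq[OF \<pi>] unfolding \<pi>'_def by metis
  have 1: "(\<Sum>k<n. cnj (monomial_mat n \<pi> z $$ (k, i)) * monomial_mat n \<pi> z $$ (k, j)) = of_bool (i = j)"
    if "i < n" "j < n" for i j
  proof -
    have "\<pi>' i < n" using permutes_in_image[OF permutes_inv[OF \<pi>], of i] that by (simp add: \<pi>'_def)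
    have "(\<Sum>k<n. cnj (monomial_mat n \<pi> z $$ (k, i)) * monomial_mat n \<pi> z $$ (k, j))
        = (\<Sum>k<n. if k = \<pi>' i then of_bool (i = j) else 0)"
      using that z' by (intro sum.cong) (auto simp: monomial_mat_def inv)
    also have "\<dots> = of_bool (i = j)" using \<open>\<pi>' i < n\<close> by simp
    finally show ?thesis .
  qed
  have 2: "(\<Sum>k<n. monomial_mat n \<pi> z $$ (i, k) * cnj (monomial_mat n \<pi> z $$ (j, k))) = of_bool (i = j)"
    if "i < n" "j < n" for i j
  proof -
    have "\<pi> i < n" using permutes_in_image[OF \<pi>, of i] that by simp
    have "\<pi> i = \<pi> j \<longleftrightarrow> i = j" using permutes_inj[OF \<pi>] by (auto dest: injD)
    then have "(\<Sum>k<n. monomial_mat n \<pi> z $$ (i, k) * cnj (monomial_mat n \<pi> z $$ (j, k)))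
        = (\<Sum>k<n. if k = \<pi> i then of_bool (i = j) else 0)"
      using that z' by (intro sum.cong) (auto simp: monomial_mat_def)
    also have "\<dots> = of_bool (i = j)" using \<open>\<pi> i < n\<close> by simp
    finally show ?thesis .
  qed
  show ?thesis using 1 2 unfolding unitary_mats_iff by (auto simp: monomial_mat_def)
qed

lemma monomial_mat_mult_index:
  assumes "\<pi> permutes {..<n}" "U \<in> carrier_mat n m" "i < n" "k < m"
  shows "(monomial_mat n \<pi> z * U) $$ (i, k) = z i * U $$ (\<pi> i, k)"
proof -
  have "\<pi> i < n" using permutes_in_image[OF assms(1), of i] assms by simp
  have "(monomial_mat n \<pi> z * U) $$ (i, k) = (\<Sum>j<n. (if j = \<pi> i then z i else 0) * U $$ (j, k))"
    using assms by (auto simp: monomial_mat_def scalar_prod_def lessThan_atLeast0 intro!: sum.cong)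
  also have "\<dots> = (\<Sum>j<n. if j = \<pi> i then z i * U $$ (\<pi> i, k) else 0)"
    by (intro sum.cong) auto
  also have "\<dots> = z i * U $$ (\<pi> i, k)" using \<open>\<pi> i < n\<close> by simp
  finally show ?thesis .
qed

lemma unitary_mats_mult:
  assumes V: "V \<in> unitary_mats n" and U: "U \<in> unitary_mats n"
  shows "V * U \<in> unitary_mats n"
proof -
  have c: "V \<in> carrier_mat n n" "U \<in> carrier_mat n n" "mat_adjoint V \<in> carrier_mat n n"
     "mat_adjoint U \<in> carrier_mat n n"
    using assms by (auto simp: unitary_mats_def)
  have adj: "mat_adjoint (V * U) = mat_adjoint U * mat_adjoint V"
    using c by (intro eq_matI) (auto simp: scalar_prod_def mult.commute)
  have "mat_adjoint (V * U) * (V * U) = mat_adjoint U * (mat_adjoint V * V) * U"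
    unfolding adj using c by (simp add: assoc_mult_mat[of _ n n _ n _ n])
  also have "\<dots> = 1\<^sub>m n" using assms c by (simp add: unitary_mats_def)
  finally have 1: "mat_adjoint (V * U) * (V * U) = 1\<^sub>m n" .
  have "(V * U) * mat_adjoint (V * U) = V * (U * mat_adjoint U) * mat_adjoint V"
    unfolding adj using c by (simp add: assoc_mult_mat[of _ n n _ n _ n])
  also have "\<dots> = 1\<^sub>m n" using assms c by (simp add: unitary_mats_def)
  finally show ?thesis using 1 c by (simp add: unitary_mats_def)
qed

section \<open>Second moments of products of column entries under the Haar measure\<close>

context
  fixes n :: nat and \<mu> :: "complex mat measure"
  assumes haar: "haar_unitary n \<mu>"
begin

interpretation prob_space \<mu>
  using haar by (simp add: haar_unitary_def)

lemma haar_sets: "sets \<mu> = sets (borel_unitary n)"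
  using haar by (simp add: haar_unitary_def)

lemma haar_space: "space \<mu> = unitary_mats n"
  using sets_eq_imp_space_eq[OF haar_sets] by (simp add: borel_unitary_def)

lemma haar_measurable_entry:
  assumes "i < n" "k < n"
  shows "(\<lambda>U. U $$ (i, k)) \<in> borel_measurable \<mu>"
proof -
  have "(\<lambda>U. \<lambda>ij\<in>{..<n} \<times> {..<n}. U $$ ij)
      \<in> measurable \<mu> (\<Pi>\<^sub>M ij\<in>{..<n} \<times> {..<n}. (borel :: complex measure))"
    unfolding measurable_cong_sets[OF haar_sets refl] borel_unitary_def
    by (rule measurable_vimage_algebra1) (auto simp: space_PiM)
  from measurable_compose[OF this measurable_component_singleton[of "(i, k)"]] assms
  show ?thesis by simp
qed

lemma haar_measurable_cnj:
  assumes "f \<in> borel_measurable \<mu>"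
  shows "(\<lambda>U. cnj (f U)) \<in> borel_measurable \<mu>"
  using measurable_compose[OF assms borel_measurable_continuous_onI[OF continuous_on_cnj]]
  by (simp add: continuous_on_id)

text \<open>The sigma-algebra is generated by the entries, so it is enough that the product is again
  unitary and that each of its entries, a multiple of an entry of \<open>U\<close>, is
  measurable.\<close>

lemma haar_measurable_monomial:
  assumes "\<pi> permutes {..<n}" "\<And>i. cmod (z i) = 1"
  shows "(\<lambda>U. monomial_mat n \<pi> z * U) \<in> measurable \<mu> \<mu>"
  unfolding measurable_cong_sets[OF refl haar_sets] borel_unitary_def
proof (rule measurable_vimage_algebra2)
  show "(\<lambda>U. monomial_mat n \<pi> z * U) \<in> space \<mu> \<rightarrow> unitary_mats n"
    using monomial_mat_unitary[OF assms] by (auto simp: haar_space unitary_mats_mult)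
  show "(\<lambda>U. \<lambda>ij\<in>{..<n} \<times> {..<n}. (monomial_mat n \<pi> z * U) $$ ij)
      \<in> measurable \<mu> (\<Pi>\<^sub>M ij\<in>{..<n} \<times> {..<n}. (borel :: complex measure))"
  proof (rule measurable_restrict)
    fix ij assume ij: "ij \<in> {..<n} \<times> {..<n}"
    obtain i k where ik: "ij = (i, k)" "i < n" "k < n" using ij by auto
    have "\<pi> i < n" using permutes_in_image[OF assms(1), of i] ik by simp
    have "(\<lambda>U. z i * U $$ (\<pi> i, k)) \<in> borel_measurable \<mu>"
      using haar_measurable_entry[OF \<open>\<pi> i < n\<close> ik(3)] by simp
    then show "(\<lambda>U. (monomial_mat n \<pi> z * U) $$ ij) \<in> borel_measurable \<mu>"
      by (rule subst[OF measurable_cong, rotated])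
        (use ik assms in \<open>auto simp: haar_space unitary_mats_def monomial_mat_mult_index\<close>)
  qed
qed

lemma haar_integral_monomial:
  fixes f :: "complex mat \<Rightarrow> 'b :: {banach, second_countable_topology}"
  assumes \<pi>: "\<pi> permutes {..<n}" and z: "\<And>i. cmod (z i) = 1" and f: "f \<in> borel_measurable \<mu>"
  shows "(\<integral>U. f (monomial_mat n \<pi> z * U) \<partial>\<mu>) = (\<integral>U. f U \<partial>\<mu>)"
proof -
  have "distr \<mu> \<mu> (\<lambda>U. monomial_mat n \<pi> z * U) = \<mu>"
    using haar monomial_mat_unitary[OF \<pi> z] by (simp add: haar_unitary_def)
  then show ?thesis
    using integral_distr[OF haar_measurable_monomial[where z = z, OF \<pi> z] f] by simp
qed

lemma haar_integrable:
  fixes f :: "complex mat \<Rightarrow> 'b :: {banach, second_countable_topology}"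
  assumes "f \<in> borel_measurable \<mu>" "\<And>U. U \<in> unitary_mats n \<Longrightarrow> norm (f U) \<le> B"
  shows "integrable \<mu> f"
  using assms by (intro integrable_const_bound[where B = B]) (auto simp: haar_space)

lemma haar_col_orthogonal:
  assumes ij: "i < n" "j < n" "i \<noteq> j" and ij': "i' < n" "j' < n" "i' \<noteq> j'"
    and ne: "(i, j) \<noteq> (i', j')" and k: "k < n"
  shows "(\<integral>U. (cnj (U $$ (i, k)) * U $$ (j, k)) * cnj (cnj (U $$ (i', k)) * U $$ (j', k)) \<partial>\<mu>) = 0"
proof -
  let ?f = "\<lambda>U :: complex mat. (cnj (U $$ (i, k)) * U $$ (j, k)) * cnj (cnj (U $$ (i', k)) * U $$ (j', k))"
  \<comment> \<open>Multiplying row \<open>m\<close> by \<open>\<i>\<close> preserves the Haar measure, but multiplies the integrand by one of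
    \<open>\<i>\<close>, \<open>-\<i>\<close>, \<open>-1\<close>.\<close>
  define m where "m = (if j = j' then i else j)"
  define z :: "nat \<Rightarrow> complex" where "z r = (if r = m then \<i> else 1)" for r
  define \<zeta> where "\<zeta> = (cnj (z i) * z j) * cnj (cnj (z i') * z j')"
  have z: "cmod (z r) = 1" for r by (simp add: z_def)
  \<comment> \<open>If \<open>j = j'\<close>, the factor \<i> occurs only at \<open>i\<close> and
    \<open>\<zeta> = -\<i>\<close>. Otherwise the factor at \<open>j\<close> is \<i>, and the one at
    \<open>i'\<close> is 1 or, when \<open>i' = j\<close>, another \<i>, so \<zeta> is \<i> or -1.
    An integral that equals \<zeta> times itself must vanish.\<close>
  have \<zeta>: "\<zeta> \<noteq> 1" using ij ij' ne by (auto simp: \<zeta>_def z_def m_def complex_eq_iff)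
  have f: "?f \<in> borel_measurable \<mu>"
    using ij ij' k by (intro borel_measurable_times haar_measurable_cnj haar_measurable_entry)
  have "(\<integral>U. ?f U \<partial>\<mu>) = (\<integral>U. ?f (monomial_mat n id z * U) \<partial>\<mu>)"
    using haar_integral_monomial[where z = z, OF permutes_id z f] by simp
  also have "\<dots> = (\<integral>U. \<zeta> * ?f U \<partial>\<mu>)"
  proof (rule Bochner_Integration.integral_cong[OF refl])
    fix U assume "U \<in> space \<mu>"
    then have "U \<in> carrier_mat n n" by (simp add: haar_space unitary_mats_def)
    from monomial_mat_mult_index[OF permutes_id this _ k]
    show "?f (monomial_mat n id z * U) = \<zeta> * ?f U"
      using ij ij' by (simp add: \<zeta>_def)
  qed
  also have "\<dots> = \<zeta> * (\<integral>U. ?f U \<partial>\<mu>)" by (rule integral_mult_right_zero)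
  finally show ?thesis using \<zeta> by simp
qed

text \<open>Permutation invariance gives the same moment for all \<open>n * (n - 1)\<close> ordered
  pairs of distinct rows, and the products over these pairs sum to at most the square of the squared
  column norm, which is 1.\<close>

lemma haar_col_moment:
  assumes ij: "i < n" "j < n" "i \<noteq> j" and k: "k < n"
  shows "(\<integral>U. (cmod (U $$ (i, k)))\<^sup>2 * (cmod (U $$ (j, k)))\<^sup>2 \<partial>\<mu>) \<le> 1 / (real n * (real n - 1))"
proof -
  let ?f = "\<lambda>i j (U :: complex mat). (cmod (U $$ (i, k)))\<^sup>2 * (cmod (U $$ (j, k)))\<^sup>2"
  define S where "S = Sigma {..<n} (\<lambda>i. {..<n} - {i})"
  have f: "?f i j \<in> borel_measurable \<mu>" if "i < n" "j < n" for i j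
  proof -
    note [measurable] = haar_measurable_entry
    show ?thesis using that k by measurable
  qed
  have int: "integrable \<mu> (?f i j)" if "i < n" "j < n" for i j
    using that k f by (intro haar_integrable[where B = 1])
      (auto intro!: mult_le_one power_le_one unitary_entry_le_1)
  have eq: "(\<integral>U. ?f i j U \<partial>\<mu>) = (\<integral>U. ?f i' j' U \<partial>\<mu>)" if "i' < n" "j' < n" "j' \<noteq> i'" for i' j'
  proof -
    \<comment> \<open>The first transposition sends \<open>i\<close> to \<open>i'\<close>; the
      second moves the image of \<open>j\<close> to \<open>j'\<close> and fixes \<open>i'\<close>,
      because neither that image nor \<open>j'\<close> equals \<open>i'\<close>.\<close>
    define \<pi> where "\<pi> = Transposition.transpose (Transposition.transpose i i' j) j' \<circ> Transposition.transpose i i'"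
    have \<pi>: "\<pi> permutes {..<n}"
      unfolding \<pi>_def using ij that
      by (intro permutes_compose permutes_swap_id) (auto simp: Transposition.transpose_def)
    have \<pi>ij: "\<pi> i = i'" "\<pi> j = j'" using ij that by (auto simp: \<pi>_def Transposition.transpose_def)
    have "(\<integral>U. ?f i j U \<partial>\<mu>) = (\<integral>U. ?f i j (monomial_mat n \<pi> (\<lambda>_. 1) * U) \<partial>\<mu>)"
      by (rule haar_integral_monomial[symmetric, OF \<pi> _ f]) (use ij in auto)
    also have "\<dots> = (\<integral>U. ?f i' j' U \<partial>\<mu>)"
    proof (rule Bochner_Integration.integral_cong[OF refl])
      fix U assume "U \<in> space \<mu>"
      then have "U \<in> carrier_mat n n" by (simp add: haar_space unitary_mats_def)
      from monomial_mat_mult_index[OF \<pi> this _ k]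
      show "?f i j (monomial_mat n \<pi> (\<lambda>_. 1) * U) = ?f i' j' U"
        using ij by (simp add: \<pi>ij)
    qed
    finally show ?thesis by simp
  qed
  have "real n * (real n - 1) * (\<integral>U. ?f i j U \<partial>\<mu>) = (\<Sum>(i', j')\<in>S. (\<integral>U. ?f i j U \<partial>\<mu>))"
    using ij by (simp add: S_def of_nat_diff)
  also have "\<dots> = (\<Sum>(i', j')\<in>S. (\<integral>U. ?f i' j' U \<partial>\<mu>))"
    by (rule sum.cong) (use eq in \<open>fastforce simp: S_def\<close>)+
  also have "\<dots> = (\<integral>U. (\<Sum>(i', j')\<in>S. ?f i' j' U) \<partial>\<mu>)"
    unfolding case_prod_beta by (rule Bochner_Integration.integral_sum[symmetric]) (use int in \<open>auto simp: S_def\<close>)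
  also have "\<dots> \<le> (\<integral>U. 1 \<partial>\<mu>)"
  proof (rule integral_mono)
    show "integrable \<mu> (\<lambda>U. \<Sum>(i', j')\<in>S. ?f i' j' U)"
      unfolding case_prod_beta by (rule Bochner_Integration.integrable_sum) (use int in \<open>auto simp: S_def\<close>)
    fix U assume "U \<in> space \<mu>"
    then have U: "U \<in> unitary_mats n" by (simp add: haar_space)
    \<comment> \<open>Adding the nonnegative diagonal terms completes the double sum to a
      square.\<close>
    have "(\<Sum>(i', j')\<in>S. ?f i' j' U) \<le> (\<Sum>(i', j')\<in>{..<n} \<times> {..<n}. ?f i' j' U)"
      by (rule sum_mono2) (auto simp: S_def)
    also have "\<dots> = (\<Sum>i<n. (cmod (U $$ (i, k)))\<^sup>2) * (\<Sum>i<n. (cmod (U $$ (i, k)))\<^sup>2)"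
      by (simp add: sum_product sum.cartesian_product)
    also have "\<dots> = 1" using unitary_col_norm[OF U k] by simp
    finally show "(\<Sum>(i', j')\<in>S. ?f i' j' U) \<le> 1" .
  qed simp
  finally have "real n * (real n - 1) * (\<integral>U. ?f i j U \<partial>\<mu>) \<le> 1" by (simp add: prob_space)
  moreover have "real n * (real n - 1) > 0" using ij by (auto simp: less_Suc_eq_le)
  ultimately show ?thesis by (simp add: pos_le_divide_eq mult.commute)
qed

text \<open>Expanding the squared modulus leaves only the terms with equal index pairs, by
  \<open>haar_col_orthogonal\<close>. The zero diagonal excludes the products with
  \<open>i = j\<close>, to which that lemma does not apply.\<close>

lemma haar_quadratic_form:
  fixes A :: "nat \<Rightarrow> nat \<Rightarrow> complex"
  assumes diag: "\<And>i. A i i = 0" and k: "k < n"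
  shows "(\<integral>U. (cmod (\<Sum>i<n. \<Sum>j<n. A i j * (cnj (U $$ (i, k)) * U $$ (j, k))))\<^sup>2 \<partial>\<mu>)
      \<le> (\<Sum>i<n. \<Sum>j<n. (cmod (A i j))\<^sup>2) / (real n * (real n - 1))"
proof -
  define S where "S = Sigma {..<n} (\<lambda>i. {..<n} - {i})"
  define a where "a = case_prod A"
  define g :: "nat \<times> nat \<Rightarrow> complex mat \<Rightarrow> complex"
    where "g = (\<lambda>(i, j) U. cnj (U $$ (i, k)) * U $$ (j, k))"
  have fin: "finite S" by (simp add: S_def)
  have off_diag: "(\<Sum>i<n. \<Sum>j<n. F i j) = (\<Sum>(i, j)\<in>S. F i j)"
    if "\<And>i. F i i = 0" for F :: "nat \<Rightarrow> nat \<Rightarrow> 'c :: comm_monoid_add"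
    unfolding sum.cartesian_product using that
    by (intro sum.mono_neutral_right) (auto simp: S_def)
  have meas: "(\<lambda>U. g s U * cnj (g t U)) \<in> borel_measurable \<mu>" if "s \<in> S" "t \<in> S" for s t
  proof -
    have "fst s < n" "snd s < n" "fst t < n" "snd t < n" using that by (auto simp: S_def)
    then show ?thesis unfolding g_def case_prod_beta using k
      by (intro borel_measurable_times haar_measurable_cnj haar_measurable_entry)
  qed
  have int: "integrable \<mu> (\<lambda>U. g s U * cnj (g t U))" if "s \<in> S" "t \<in> S" for s t
    using that k meas[OF that] by (intro haar_integrable[where B = 1])
      (auto simp: S_def g_def norm_mult intro!: mult_le_one unitary_entry_le_1)
  have orth: "(\<integral>U. g s U * cnj (g t U) \<partial>\<mu>) = 0" if "s \<in> S" "t \<in> S" "s \<noteq> t" for s t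
    using that k haar_col_orthogonal unfolding g_def S_def by fastforce
  have sq: "(\<integral>U. g s U * cnj (g s U) \<partial>\<mu>) = of_real (\<integral>U. (cmod (g s U))\<^sup>2 \<partial>\<mu>)" for s
    by (simp add: complex_norm_square[symmetric] integral_complex_of_real del: of_real_power)
  have mom: "(\<integral>U. (cmod (g s U))\<^sup>2 \<partial>\<mu>) \<le> 1 / (real n * (real n - 1))" if s_S: "s \<in> S" for s
  proof -
    obtain i j where s: "s = (i, j)" "i < n" "j < n" "i \<noteq> j"
      using s_S by (cases s) (auto simp: S_def)
    show ?thesis using haar_col_moment[OF s(2-4) k] by (simp add: s(1) g_def norm_mult power_mult_distrib)
  qed
  \<comment> \<open>The real moment is computed as a complex integral, where the squared modulus
    splits into a sum times its conjugate.\<close>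
  have "complex_of_real (\<integral>U. (cmod (\<Sum>i<n. \<Sum>j<n. A i j * (cnj (U $$ (i, k)) * U $$ (j, k))))\<^sup>2 \<partial>\<mu>)
      = complex_of_real (\<integral>U. (cmod (\<Sum>s\<in>S. a s * g s U))\<^sup>2 \<partial>\<mu>)"
    by (subst off_diag) (simp_all add: diag a_def g_def case_prod_beta)
  also have "\<dots> = (\<integral>U. (\<Sum>s\<in>S. \<Sum>t\<in>S. (a s * cnj (a t)) * (g s U * cnj (g t U))) \<partial>\<mu>)"
    by (simp only: integral_complex_of_real[symmetric] complex_norm_square cnj_sum sum_product
        complex_cnj_mult mult_ac)
  also have "\<dots> = (\<Sum>s\<in>S. \<Sum>t\<in>S. (a s * cnj (a t)) * (\<integral>U. g s U * cnj (g t U) \<partial>\<mu>))"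
    using int by (simp add: Bochner_Integration.integral_sum Bochner_Integration.integrable_sum)
  also have "\<dots> = (\<Sum>s\<in>S. \<Sum>t\<in>S. if t = s then (a s * cnj (a s)) * (\<integral>U. g s U * cnj (g s U) \<partial>\<mu>) else 0)"
    using orth by (intro sum.cong) auto
  also have "\<dots> = complex_of_real (\<Sum>s\<in>S. (cmod (a s))\<^sup>2 * (\<integral>U. (cmod (g s U))\<^sup>2 \<partial>\<mu>))"
    using fin by (simp add: sq complex_norm_square del: of_real_power)
  finally have "(\<integral>U. (cmod (\<Sum>i<n. \<Sum>j<n. A i j * (cnj (U $$ (i, k)) * U $$ (j, k))))\<^sup>2 \<partial>\<mu>)
      = (\<Sum>s\<in>S. (cmod (a s))\<^sup>2 * (\<integral>U. (cmod (g s U))\<^sup>2 \<partial>\<mu>))"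
    unfolding of_real_eq_iff .
  also have "\<dots> \<le> (\<Sum>s\<in>S. (cmod (a s))\<^sup>2 * (1 / (real n * (real n - 1))))"
    using mom by (intro sum_mono mult_left_mono) auto
  also have "\<dots> = (\<Sum>i<n. \<Sum>j<n. (cmod (A i j))\<^sup>2) / (real n * (real n - 1))"
    by (subst off_diag) (simp_all add: diag a_def case_prod_beta sum_divide_distrib)
  finally show ?thesis .
qed

end

section \<open>The conjugate subgroups and the one-dimensional representations\<close>

lemma add_mult_mod:
  fixes c x y n :: nat
  shows "(c + x * (y mod n)) mod n = (c + x * y) mod n" "(c + x mod n * y) mod n = (c + x * y) mod n"
  by (metis mod_add_right_eq mod_mult_right_eq, metis mod_add_right_eq mod_mult_left_eq)

section \<open>The affine group and the conjugates of its base subgroup\<close>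

lemma affine_group_simps:
  "carrier (affine_group p) = {1..<p} \<times> {..<p}"
  "(\<alpha>1, \<gamma>1) \<otimes>\<^bsub>affine_group p\<^esub> (\<alpha>2, \<gamma>2) = (\<alpha>1 * \<alpha>2 mod p, (\<gamma>1 + \<alpha>1 * \<gamma>2) mod p)"
  "\<one>\<^bsub>affine_group p\<^esub> = (1, 0)"
  by (simp_all add: affine_group_def)

lemma prime_unit_mult_mod:
  fixes p :: nat
  assumes "prime p" "x \<in> {1..<p}" "y \<in> {1..<p}"
  shows "x * y mod p \<in> {1..<p}"
proof -
  have "\<not> p dvd x" "\<not> p dvd y" using assms by (auto dest: dvd_imp_le)
  then have "\<not> p dvd x * y" using assms(1) by (simp add: prime_dvd_mult_iff)
  then show ?thesis using assms by (simp add: dvd_eq_mod_eq_0 Suc_le_eq)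
qed

lemma coprime_prime_unit:
  fixes p :: nat
  assumes "prime p" "x \<in> {1..<p}"
  shows "coprime p x"
  using assms by (metis atLeastLessThan_iff leD nat_dvd_not_less not_one_le_zero
      prime_imp_coprime zero_less_iff_neq_zero)

lemma prime_unit_inverse:
  fixes p :: nat
  assumes "prime p" "x \<in> {1..<p}"
  obtains y where "y \<in> {1..<p}" "x * y mod p = 1"
proof -
  have "coprime x p"
    using coprime_prime_unit[OF assms] by (simp add: coprime_commute)
  then obtain y where y: "[x * y = 1] (mod p)" using cong_solve_coprime_nat by auto
  have p: "p > 1" using assms(1) prime_gt_1_nat by blast
  have "x * (y mod p) mod p = 1" using y p by (simp add: cong_def mod_mult_right_eq)
  moreover from this have "y mod p \<noteq> 0" using p by (intro notI) simp
  ultimately show ?thesis using p by (intro that[of "y mod p"]) auto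
qed

lemma group_affine_group:
  assumes p: "prime p"
  shows "group (affine_group p)"
proof (rule groupI)
  have p1: "p > 1" using p prime_gt_1_nat by blast
  show "\<one>\<^bsub>affine_group p\<^esub> \<in> carrier (affine_group p)"
    using p1 by (simp add: affine_group_simps)
  fix x assume x: "x \<in> carrier (affine_group p)"
  obtain \<alpha> \<gamma> where xe: "x = (\<alpha>, \<gamma>)" by (cases x)
  with x have x': "\<alpha> \<in> {1..<p}" "\<gamma> < p" by (auto simp: affine_group_simps)
  show "\<one>\<^bsub>affine_group p\<^esub> \<otimes>\<^bsub>affine_group p\<^esub> x = x"
    using x' by (simp add: xe affine_group_simps)
  obtain \<beta> where \<beta>: "\<beta> \<in> {1..<p}" "\<alpha> * \<beta> mod p = 1"
    using prime_unit_inverse[OF p x'(1)] .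
  show "\<exists>y\<in>carrier (affine_group p). y \<otimes>\<^bsub>affine_group p\<^esub> x = \<one>\<^bsub>affine_group p\<^esub>"
  proof
    show "(\<beta>, \<beta> * (p - \<gamma>) mod p) \<in> carrier (affine_group p)"
      using \<beta> p1 by (simp add: affine_group_simps)
    have "(\<beta> * (p - \<gamma>) mod p + \<beta> * \<gamma>) mod p = \<beta> * ((p - \<gamma>) + \<gamma>) mod p"
      by (simp add: mod_simps ring_distribs)
    also have "\<dots> = 0" using x' by simp
    finally show "(\<beta>, \<beta> * (p - \<gamma>) mod p) \<otimes>\<^bsub>affine_group p\<^esub> x = \<one>\<^bsub>affine_group p\<^esub>"
      using \<beta> by (simp add: xe affine_group_simps mult.commute)
  qed
  fix y assume y: "y \<in> carrier (affine_group p)"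
  then show "x \<otimes>\<^bsub>affine_group p\<^esub> y \<in> carrier (affine_group p)"
    using x prime_unit_mult_mod[OF p] p1 by (auto simp: affine_group_simps)
  fix z assume z: "z \<in> carrier (affine_group p)"
  obtain \<alpha>2 \<gamma>2 \<alpha>3 \<gamma>3 where yz: "y = (\<alpha>2, \<gamma>2)" "z = (\<alpha>3, \<gamma>3)" by (cases y, cases z)
  have "((\<gamma> + \<alpha> * \<gamma>2) mod p + \<alpha> * \<alpha>2 mod p * \<gamma>3) mod p = (\<gamma> + \<alpha> * ((\<gamma>2 + \<alpha>2 * \<gamma>3) mod p)) mod p"
    by (simp add: add_mult_mod mod_add_left_eq) (simp add: algebra_simps)
  then show "x \<otimes>\<^bsub>affine_group p\<^esub> y \<otimes>\<^bsub>affine_group p\<^esub> z = x \<otimes>\<^bsub>affine_group p\<^esub> (y \<otimes>\<^bsub>affine_group p\<^esub> z)"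
    by (simp add: xe yz affine_group_simps mod_simps mult.assoc)
qed

text \<open>For a unit \<open>a\<close> this is the cyclic group generated by \<open>a\<close>;
  natural exponents suffice because the order is finite.\<close>

definition unit_powers :: "nat \<Rightarrow> nat \<Rightarrow> nat set" where
  "unit_powers p a = range (\<lambda>k. a ^ k mod p)"

lemma base_subgroup_eq:
  assumes p: "prime p" and a: "a \<in> {1..<p}"
  shows "base_subgroup p a = unit_powers p a \<times> {0}"
proof -
  interpret group "affine_group p" by (rule group_affine_group[OF p])
  have p1: "p > 1" using p prime_gt_1_nat by blast
  have pow: "(a, 0) [^]\<^bsub>affine_group p\<^esub> k = (a ^ k mod p, 0)" for k :: nat
    using p1 by (induction k) (simp_all add: affine_group_simps mod_simps mult.commute)
  have "base_subgroup p a = {(a, 0) [^]\<^bsub>affine_group p\<^esub> k | k. k \<in> (UNIV :: nat set)}"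
    unfolding base_subgroup_def using a
    by (intro generate_pow_on_finite_carrier) (auto simp: affine_group_simps)
  then show ?thesis by (auto simp: pow unit_powers_def)
qed

text \<open>The product (1, b)(x, 0)(1, -b) is (x, b - x b), with \<open>p - b\<close> standing for
  -b. The first component determines the element, so sums over the conjugate become sums over the
  powers of \<open>a\<close>.\<close>

lemma conj_subgroup_eq:
  assumes p: "prime p" and a: "a \<in> {1..<p}" and b: "b < p"
  shows "conj_subgroup p a b = (\<lambda>x. (x, (b + x * (p - b)) mod p)) ` unit_powers p a"
proof -
  have x: "x mod p = x" if "x \<in> unit_powers p a" for x using that by (auto simp: unit_powers_def)
  have "conj_subgroup p a b = (\<lambda>x. (x mod p mod p, (b + x mod p * ((p - b) mod p)) mod p)) ` unit_powers p a"
    unfolding conj_subgroup_def base_subgroup_eq[OF p a] using b prime_gt_1_nat[OF p]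
    by (force simp: affine_group_simps image_iff)
  also have "\<dots> = (\<lambda>x. (x, (b + x * (p - b)) mod p)) ` unit_powers p a"
    by (intro image_cong) (simp_all add: x add_mult_mod)
  finally show ?thesis .
qed

lemma one_in_unit_powers: "p > 1 \<Longrightarrow> 1 \<in> unit_powers p a"
  unfolding unit_powers_def by (auto simp: image_iff intro!: exI[of _ 0])

lemma unit_powers_mult:
  assumes "x \<in> unit_powers p a" "y \<in> unit_powers p a"
  shows "x * y mod p \<in> unit_powers p a"
  using assms unfolding unit_powers_def by (auto simp: mod_simps power_add[symmetric])

lemma order_affine_group: "order (affine_group p) = (p - 1) * p"
  by (simp add: order_def affine_group_simps)

section \<open>Characters of the unit group and their outcome probabilities\<close>

lemma unit_char_power:
  assumes p: "prime p" and \<psi>: "\<psi> \<in> unit_chars p" and x: "x \<in> {1..<p}"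
  shows "\<psi> (x ^ k mod p) = \<psi> x ^ k"
proof (induction k)
  case 0
  have o: "(1::nat) \<in> {1..<p}" using prime_gt_1_nat[OF p] by simp
  have "\<psi> (1 * 1 mod p) = \<psi> 1 * \<psi> 1" "\<psi> 1 \<noteq> 0" using \<psi> o unfolding unit_chars_def by blast+
  then show ?case using prime_gt_1_nat[OF p] by simp
next
  case (Suc k)
  have "\<not> p dvd x" using x by (auto dest: dvd_imp_le)
  then have "\<not> p dvd x ^ k" using p prime_dvd_power by blast
  then have "x ^ k mod p \<in> {1..<p}" using prime_gt_1_nat[OF p] by (simp add: dvd_eq_mod_eq_0 Suc_le_eq)
  then have "\<psi> (x * (x ^ k mod p) mod p) = \<psi> x * \<psi> (x ^ k mod p)"
    using \<psi> x unfolding unit_chars_def by blast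
  then show ?case using Suc by (simp add: mod_mult_right_eq)
qed

lemma unit_char_power_eq_1:
  assumes p: "prime p" and \<psi>: "\<psi> \<in> unit_chars p" and x: "x \<in> {1..<p}" and "x ^ k mod p = 1"
  shows "\<psi> x ^ k = 1"
  using unit_char_power[OF p \<psi> x, of k] unit_char_power[OF p \<psi> x, of 0] prime_gt_1_nat[OF p] assms by simp

context
  fixes p a q :: nat
  assumes p: "prime p" and a: "a \<in> {1..<p}" and q: "q = ord p a"
begin

lemma q_pos: "q > 0" using coprime_prime_unit[OF p a] q by simp

lemma a_pow_q: "a ^ q mod p = 1" using ord[of a p] prime_gt_1_nat[OF p] q by (simp add: cong_def)

lemma a_pow_mod_q: "a ^ (k mod q) mod p = a ^ k mod p"
proof -
  have "a ^ k mod p = (a ^ q mod p) ^ (k div q) mod p * (a ^ (k mod q)) mod p"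
    by (simp add: mod_simps power_mult[symmetric] power_add[symmetric])
  then show ?thesis using prime_gt_1_nat[OF p] by (simp add: a_pow_q)
qed

lemma unit_powers_eq: "unit_powers p a = (\<lambda>k. a ^ k mod p) ` {..<q}"
  unfolding unit_powers_def using q_pos a_pow_mod_q
  by (auto simp: image_iff) (metis mod_less_divisor lessThan_iff)

lemma inj_unit_powers: "inj_on (\<lambda>k. a ^ k mod p) {..<q}"
  unfolding q by (rule inj_power_mod[OF coprime_prime_unit[OF p a]])

lemma finite_unit_powers: "finite (unit_powers p a)" by (simp add: unit_powers_eq)

lemma card_unit_powers: "card (unit_powers p a) = q"
  by (simp add: unit_powers_eq card_image[OF inj_unit_powers])

lemma unit_powers_subset: "unit_powers p a \<subseteq> {1..<p}"
proof
  fix x assume "x \<in> unit_powers p a"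
  then obtain k where k: "x = a ^ k mod p" by (auto simp: unit_powers_def)
  have "\<not> p dvd a" using a by (auto dest: dvd_imp_le)
  then have "\<not> p dvd a ^ k" using p prime_dvd_power by blast
  then show "x \<in> {1..<p}" using prime_gt_1_nat[OF p] by (simp add: k dvd_eq_mod_eq_0 Suc_le_eq)
qed

lemma unit_powers_inverse:
  assumes "x \<in> unit_powers p a"
  obtains y where "y \<in> unit_powers p a" "x * y mod p = 1"
proof -
  obtain k where k: "x = a ^ k mod p" "k < q" using assms by (auto simp: unit_powers_eq)
  have "x * (a ^ (q - k) mod p) mod p = 1"
    using k a_pow_q by (simp add: mod_simps power_add[symmetric])
  then show ?thesis by (intro that[of "a ^ (q - k) mod p"]) (auto simp: unit_powers_def)
qed

lemma card_conj_subgroup: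
  assumes "b < p"
  shows "card (conj_subgroup p a b) = q"
  unfolding conj_subgroup_eq[OF p a assms] by (subst card_image) (auto simp: inj_on_def card_unit_powers)

lemma sum_conj_subgroup:
  assumes "b < p"
  shows "(\<Sum>h\<in>conj_subgroup p a b. f h) = (\<Sum>x\<in>unit_powers p a. f (x, (b + x * (p - b)) mod p))"
  unfolding conj_subgroup_eq[OF p a assms] by (subst sum.reindex) (auto simp: inj_on_def)

text \<open>A one-dimensional representation reads only the first component, which conjugation
  leaves alone. Hence \<open>b\<close> is absent from the right-hand side, and these outcomes cancel
  in the total variation.\<close>

lemma outcome_prob_char:
  assumes b: "b < p"
  shows "outcome_prob p a U b (Char_outcome \<psi>) =
    real q / (real (p - 1) * real p) * (cmod ((\<Sum>x\<in>unit_powers p a. \<psi> x) / of_nat q))\<^sup>2"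
  using b by (simp add: fourier_prob_def card_conj_subgroup order_affine_group vec_norm2_def
      rep_average_def scalar_prod_def sum_conj_subgroup char_rep_def unit_vec_def)

text \<open>This is a geometric series whose ratio \<open>\<psi> a\<close> is a \<open>q\<close>-th
  root of unity.\<close>

lemma unit_char_sum:
  assumes \<psi>: "\<psi> \<in> unit_chars p"
  shows "(\<Sum>x\<in>unit_powers p a. \<psi> x) = (if \<psi> a = 1 then of_nat q else 0)"
proof -
  have "(\<Sum>x\<in>unit_powers p a. \<psi> x) = (\<Sum>k<q. \<psi> a ^ k)"
    unfolding unit_powers_eq sum.reindex[OF inj_unit_powers]
    using unit_char_power[OF p \<psi> a] by simp
  also have "\<dots> = (if \<psi> a = 1 then of_nat q else 0)"
    using unit_char_power_eq_1[OF p \<psi> a a_pow_q] geometric_sum[of "\<psi> a" q] by auto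
  finally show ?thesis .
qed

text \<open>These are the characters of the quotient by the group generated by \<open>a\<close>,
  which is cyclic of order \<open>(p - 1) / q\<close>. The proof evaluates them at a primitive root
  \<open>g'\<close>: if \<open>a\<close> is \<open>g' ^ k\<close> modulo \<open>p\<close> and
  \<open>d = gcd k (p - 1) = (p - 1) / q\<close>, the values are \<open>d\<close>-th roots of unity,
  and each value determines its character.\<close>

lemma card_unit_chars_trivial:
  "real (card {\<psi> \<in> unit_chars p. \<psi> a = 1}) \<le> real (p - 1) / real q"
proof -
  obtain g where g: "residue_primroot p g" using prime_primitive_root_exists[OF prime_gt_1_nat[OF p] p] by blast
  have gen: "bij_betw (\<lambda>i. g ^ i mod p) {..<totient p} (totatives p)"
    by (rule residue_primroot_is_generator[OF prime_gt_1_nat[OF p] g])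
  \<comment> \<open>Reduction modulo \<open>p\<close> puts the primitive root into
    \<open>{1..<p}\<close>, the set on which characters carry information.\<close>
  define g' where "g' = g mod p"
  have "coprime p g" using g by (auto simp: residue_primroot_def coprime_commute)
  then have "\<not> p dvd g" using prime_gt_1_nat[OF p] by (metis coprime_absorb_left less_irrefl nat_dvd_1_iff_1)
  then have g': "g' \<in> {1..<p}" using prime_gt_1_nat[OF p] by (simp add: g'_def dvd_eq_mod_eq_0 Suc_le_eq)
  have gen': "\<exists>k. x = g' ^ k mod p" if "x \<in> {1..<p}" for x
  proof -
    have "x \<in> totatives p" using that p by (auto simp: totatives_prime)
    then show ?thesis using gen by (auto simp: bij_betw_def g'_def mod_simps)
  qed
  obtain k where k: "a = g' ^ k mod p" using gen'[OF a] by blast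
  have og: "ord p g' = p - 1" using g by (simp add: g'_def residue_primroot_def totient_prime p)
  define d where "d = gcd k (p - 1)"
  have "q = (p - 1) div d" unfolding q k ord_mod d_def og[symmetric]
    by (rule ord_power[OF coprime_prime_unit[OF p g']])
  moreover have d: "d > 0" "d dvd p - 1" using prime_gt_1_nat[OF p] by (auto simp: d_def)
  ultimately have dq: "d * q = p - 1" by simp
  have root: "\<psi> g' ^ d = 1" if \<psi>: "\<psi> \<in> unit_chars p" "\<psi> a = 1" for \<psi>
  proof -
    have 1: "\<psi> g' ^ k = 1" using unit_char_power[OF p \<psi>(1) g', of k] \<psi>(2) k by simp
    have "g' ^ (p - 1) mod p = 1" using ord[of g' p] prime_gt_1_nat[OF p] by (simp add: og cong_def)
    then have 2: "\<psi> g' ^ (p - 1) = 1" by (rule unit_char_power_eq_1[OF p \<psi>(1) g'])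
    \<comment> \<open>Bezout's identity over the naturals writes \<open>d\<close> as a difference of
      multiples of \<open>p - 1\<close> and \<open>k\<close>. The powers of \<open>\<psi> g'\<close>
      at both are 1, hence so is the one at \<open>d\<close>.\<close>
    have "p - 1 \<noteq> 0" using prime_gt_1_nat[OF p] by simp
    then obtain x y where xy: "(p - 1) * x = k * y + d"
      using bezout_nat[of "p - 1" k] unfolding d_def by (metis gcd.commute)
    have "\<psi> g' ^ ((p - 1) * x) = \<psi> g' ^ (k * y) * \<psi> g' ^ d" unfolding xy power_add ..
    then show ?thesis by (simp add: power_mult 1 2[unfolded One_nat_def])
  qed
  have inj: "inj_on (\<lambda>\<psi>. \<psi> g') {\<psi> \<in> unit_chars p. \<psi> a = 1}"
  proof (rule inj_onI)
    fix \<psi> \<phi> assume A: "\<psi> \<in> {\<psi> \<in> unit_chars p. \<psi> a = 1}" "\<phi> \<in> {\<psi> \<in> unit_chars p. \<psi> a = 1}" "\<psi> g' = \<phi> g'"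
    show "\<psi> = \<phi>"
    proof (rule extensionalityI[of _ "{1..<p}"])
      show "\<psi> \<in> extensional {1..<p}" "\<phi> \<in> extensional {1..<p}" using A by (auto simp: unit_chars_def)
      fix x assume "x \<in> {1..<p}"
      then obtain j where j: "x = g' ^ j mod p" using gen' by blast
      show "\<psi> x = \<phi> x"
        using A unit_char_power[OF p _ g', of \<psi> j] unit_char_power[OF p _ g', of \<phi> j] by (simp add: j)
    qed
  qed
  have "card {\<psi> \<in> unit_chars p. \<psi> a = 1} \<le> card {z :: complex. z ^ d = 1}"
    by (rule card_inj_on_le[OF inj]) (use root d in \<open>auto intro!: finite_roots_unity\<close>)
  also have "\<dots> = d" by (rule card_roots_unity_eq[OF d(1)])
  finally have "real (card {\<psi> \<in> unit_chars p. \<psi> a = 1}) \<le> real d" by simp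
  also have "real d = real (p - 1) / real q" using q_pos dq[symmetric] by simp
  finally show ?thesis .
qed

text \<open>Only characters with \<open>\<psi> a = 1\<close> have positive weight, namely
  \<open>q / ((p - 1) * p)\<close> each, and there are at most \<open>(p - 1) / q\<close> of
  them.\<close>

lemma sum_outcome_prob_char:
  assumes b: "b < p"
  shows "(\<Sum>\<psi>\<in>unit_chars p. outcome_prob p a U b (Char_outcome \<psi>)) \<le> 1 / real p"
proof -
  have "(\<Sum>\<psi>\<in>unit_chars p. outcome_prob p a U b (Char_outcome \<psi>))
      = (\<Sum>\<psi>\<in>unit_chars p. if \<psi> a = 1 then real q / (real (p - 1) * real p) else 0)"
    using q_pos by (intro sum.cong) (simp_all add: outcome_prob_char[OF b] unit_char_sum del: outcome_prob.simps)
  also have "\<dots> = real q / (real (p - 1) * real p) * real (card {\<psi> \<in> unit_chars p. \<psi> a = 1})"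
    by (subst sum.inter_filter[symmetric]) (simp_all add: finite_unit_chars[OF p])
  also have "\<dots> \<le> real q / (real (p - 1) * real p) * (real (p - 1) / real q)"
    by (intro mult_left_mono card_unit_chars_trivial) simp
  also have "\<dots> = 1 / real p" using q_pos prime_gt_1_nat[OF p] by simp
  finally show ?thesis .
qed

end

section \<open>The projections of the large representation\<close>

definition root_p :: "nat \<Rightarrow> complex" where
  "root_p p = exp (2 * of_real pi * \<i> / of_nat p)"

lemma cmod_root_p_power: "cmod (root_p p ^ k) = 1"
proof -
  have "root_p p = exp (\<i> * of_real (2 * pi / real p))" by (simp add: root_p_def mult_ac)
  then show ?thesis by (simp only: norm_power norm_exp_i_times power_one)
qed

lemma root_p_cnj: "root_p p ^ k * cnj (root_p p ^ k) = 1"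
  using complex_norm_square[of "root_p p ^ k"] cmod_root_p_power[of p k] by simp

lemma root_p_mod:
  assumes "p > 0"
  shows "root_p p ^ (k mod p) = root_p p ^ k"
proof -
  have "root_p p ^ p = exp (of_nat p * (2 * of_real pi * \<i> / of_nat p))"
    unfolding root_p_def by (rule exp_of_nat_mult[symmetric])
  also have "\<dots> = 1" using assms by simp
  finally have "root_p p ^ (p * (k div p) + k mod p) = root_p p ^ (k mod p)"
    by (simp only: power_add power_mult power_one mult_1)
  then show ?thesis by simp
qed

text \<open>Index \<open>j\<close> stands for the residue \<open>j + 1\<close>; related indices have
  residues in the same coset of the group generated by \<open>a\<close>.\<close>

definition orbit_rel :: "nat \<Rightarrow> nat \<Rightarrow> nat \<Rightarrow> nat \<Rightarrow> bool" where
  "orbit_rel p a j k \<longleftrightarrow> (\<exists>x\<in>unit_powers p a. k + 1 = x * (j + 1) mod p)"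

text \<open>Closed form of the projection: averaging over each coset, conjugated by the diagonal
  matrix of phases \<open>root_p p ^ (b * (j + 1))\<close>. The conjugate replaces a negative
  exponent.\<close>

definition proj_entry :: "nat \<Rightarrow> nat \<Rightarrow> nat \<Rightarrow> nat \<Rightarrow> nat \<Rightarrow> complex" where
  "proj_entry p a b j k = of_bool (orbit_rel p a j k) / of_nat (ord p a) *
     (root_p p ^ (b * (j + 1)) * cnj (root_p p ^ (b * (k + 1))))"

lemma sum_swap3:
  "(\<Sum>i\<in>A. \<Sum>j\<in>B. \<Sum>k\<in>C. f i j k) = (\<Sum>j\<in>B. \<Sum>k\<in>C. \<Sum>i\<in>A. f i j k)"
  by (rule trans[OF sum.swap], rule sum.cong[OF refl], rule sum.swap)

context
  fixes p a q :: nat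
  assumes p: "prime p" and a: "a \<in> {1..<p}" and q: "q = ord p a"
begin

text \<open>The residue \<open>j + 1\<close> is invertible, so the units act freely on nonzero
  residues. Hence at most one group element contributes to any entry of the averaged
  representation.\<close>

lemma orbit_unique:
  assumes "j < p - 1" "x \<in> unit_powers p a" "y \<in> unit_powers p a"
    "x * (j + 1) mod p = y * (j + 1) mod p"
  shows "x = y"
proof -
  have "coprime (j + 1) p" using coprime_prime_unit[OF p, of "j + 1"] assms(1) by (simp add: coprime_commute)
  then have "[x = y] (mod p)" using assms(4) by (metis cong_def cong_mult_rcancel_nat)
  moreover have "x < p" "y < p" using unit_powers_subset[OF p a q] assms by auto
  ultimately show ?thesis by (simp add: cong_def)
qed

lemma orbit_refl: "j < p - 1 \<Longrightarrow> orbit_rel p a j j"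
  unfolding orbit_rel_def using one_in_unit_powers[OF prime_gt_1_nat[OF p]] by (intro bexI[of _ 1]) auto

lemma orbit_sym:
  assumes "j < p - 1" "orbit_rel p a j k"
  shows "orbit_rel p a k j"
proof -
  obtain x where x: "x \<in> unit_powers p a" "k + 1 = x * (j + 1) mod p"
    using assms unfolding orbit_rel_def by blast
  obtain y where y: "y \<in> unit_powers p a" "x * y mod p = 1"
    using unit_powers_inverse[OF p a q x(1)] .
  have "y * (k + 1) mod p = y * (x * (j + 1)) mod p" unfolding x(2) by (rule mod_mult_right_eq)
  also have "\<dots> = (x * y mod p) * (j + 1) mod p" by (metis mod_mult_left_eq mult.assoc mult.commute)
  also have "\<dots> = j + 1" using assms y by simp
  finally show ?thesis unfolding orbit_rel_def using y(1) by metis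
qed

lemma orbit_trans:
  assumes "orbit_rel p a j k" "orbit_rel p a k l"
  shows "orbit_rel p a j l"
proof -
  obtain x y where x: "x \<in> unit_powers p a" "k + 1 = x * (j + 1) mod p"
    and y: "y \<in> unit_powers p a" "l + 1 = y * (k + 1) mod p"
    using assms unfolding orbit_rel_def by blast
  have "l + 1 = (y * x mod p) * (j + 1) mod p"
    unfolding y(2) x(2) by (metis mod_mult_left_eq mod_mult_right_eq mult.assoc)
  then show ?thesis unfolding orbit_rel_def using unit_powers_mult[OF y(1) x(1)] by metis
qed

lemma card_orbit:
  assumes j: "j < p - 1"
  shows "card {k. k < p - 1 \<and> orbit_rel p a j k} = q"
proof -
  \<comment> \<open>The subtraction of 1 returns from residues to indices; it is exact because the
    residue is nonzero.\<close>
  define F where "F x = x * (j + 1) mod p - 1" for x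
  have F: "F x + 1 = x * (j + 1) mod p" "F x < p - 1" if "x \<in> unit_powers p a" for x
  proof -
    have "x * (j + 1) mod p \<in> {1..<p}"
      using that j unit_powers_subset[OF p a q] by (intro prime_unit_mult_mod[OF p]) auto
    then show "F x + 1 = x * (j + 1) mod p" "F x < p - 1" by (auto simp: F_def)
  qed
  have "inj_on F (unit_powers p a)"
    by (rule inj_onI) (metis F(1) orbit_unique[OF j])
  moreover have "F ` unit_powers p a = {k. k < p - 1 \<and> orbit_rel p a j k}"
  proof (rule Set.set_eqI)
    fix k
    have "k \<in> F ` unit_powers p a \<longleftrightarrow> (\<exists>x\<in>unit_powers p a. F x = k \<and> k < p - 1)"
      using F(2) by blast
    also have "\<dots> \<longleftrightarrow> (\<exists>x\<in>unit_powers p a. k + 1 = x * (j + 1) mod p \<and> k < p - 1)"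
      by (intro bex_cong refl) (metis F(1) add_right_cancel)
    also have "\<dots> \<longleftrightarrow> k \<in> {k. k < p - 1 \<and> orbit_rel p a j k}"
      unfolding orbit_rel_def by blast
    finally show "k \<in> F ` unit_powers p a \<longleftrightarrow> k \<in> {k. k < p - 1 \<and> orbit_rel p a j k}" .
  qed
  ultimately show ?thesis using card_image card_unit_powers[OF p a q] by metis
qed

lemma sum_orbit:
  assumes "j < p - 1"
  shows "(\<Sum>k<p - 1. of_bool (orbit_rel p a j k) :: 'r :: semiring_1) = of_nat q"
  using card_orbit[OF assms] by (simp add: Int_def lessThan_def)

text \<open>If \<open>k + 1\<close> is \<open>x * (j + 1)\<close> modulo \<open>p\<close>, the
  exponent (b - x b)(j + 1) is congruent to b (j + 1) - b (k + 1), so the phase depends on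
  \<open>x\<close> only through \<open>k\<close>.\<close>

lemma rep_average_rho_index:
  assumes j: "j < p - 1" and k: "k < p - 1" and b: "b < p"
  shows "rep_average (p - 1) (conj_subgroup p a b) (rho p) $$ (j, k) = proj_entry p a b j k"
proof -
  define w where "w = root_p p ^ (b * (j + 1)) * cnj (root_p p ^ (b * (k + 1)))"
  have summand: "root_p p ^ ((b + x * (p - b)) mod p * (j + 1)) = w"
    if "k + 1 = x * (j + 1) mod p" for x
  proof -
    have "root_p p ^ ((b + x * (p - b)) mod p * (j + 1)) = root_p p ^ ((b + x * (p - b)) * (j + 1))"
      by (metis root_p_mod[OF prime_gt_0_nat[OF p]] mod_mult_left_eq)
    also have "\<dots> = root_p p ^ (b * (j + 1)) * root_p p ^ ((p - b) * (x * (j + 1)))"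
      unfolding power_add[symmetric] by (simp only: ring_distribs mult_ac)
    also have "root_p p ^ ((p - b) * (x * (j + 1))) = root_p p ^ ((p - b) * (k + 1))"
      by (metis that root_p_mod[OF prime_gt_0_nat[OF p]] mod_mult_right_eq)
    \<comment> \<open>Inserting a phase times its conjugate, which is 1, completes the exponent to a
      multiple of \<open>p\<close> and leaves only the conjugate.\<close>
    also have "\<dots> = root_p p ^ ((p - b) * (k + 1)) * (root_p p ^ (b * (k + 1)) * cnj (root_p p ^ (b * (k + 1))))"
      unfolding root_p_cnj by simp
    also have "\<dots> = root_p p ^ ((p - b) * (k + 1) + b * (k + 1)) * cnj (root_p p ^ (b * (k + 1)))"
      unfolding power_add by (simp only: mult_ac)
    also have "(p - b) * (k + 1) + b * (k + 1) = p * (k + 1)"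
      using b by (simp add: distrib_right[symmetric] del: mult_Suc_right)
    also have "root_p p ^ (p * (k + 1)) = 1"
      using root_p_mod[OF prime_gt_0_nat[OF p], of "p * (k + 1)"] by simp
    finally show ?thesis by (simp add: w_def)
  qed
  have "(\<Sum>h\<in>conj_subgroup p a b. rho p h $$ (j, k))
      = (\<Sum>x\<in>unit_powers p a. if k + 1 = x * (j + 1) mod p then w else 0)"
    unfolding sum_conj_subgroup[OF p a q b]
  proof (rule sum.cong[OF refl])
    fix x
    show "rho p (x, (b + x * (p - b)) mod p) $$ (j, k) = (if k + 1 = x * (j + 1) mod p then w else 0)"
      using j k summand[of x] unfolding rho_def root_p_def by simp
  qed
  also have "\<dots> = of_bool (orbit_rel p a j k) * w"
  proof (cases "orbit_rel p a j k")
    case True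
    then obtain x where x: "x \<in> unit_powers p a" "k + 1 = x * (j + 1) mod p" unfolding orbit_rel_def by blast
    have "(\<Sum>y\<in>unit_powers p a. if k + 1 = y * (j + 1) mod p then w else 0)
        = (\<Sum>y\<in>unit_powers p a. if y = x then w else 0)"
      by (intro sum.cong refl if_cong) (use x orbit_unique[OF j] in metis)
    then show ?thesis using True x by (simp add: finite_unit_powers[OF p a q])
  next
    case False
    then show ?thesis unfolding orbit_rel_def by (auto intro!: sum.neutral)
  qed
  finally show ?thesis
    using j k by (simp add: rep_average_def proj_entry_def q[symmetric] card_conj_subgroup[OF p a q b] w_def)
qed

lemma proj_entry_cnj:
  assumes "j < p - 1" "k < p - 1"
  shows "cnj (proj_entry p a b j k) = proj_entry p a b k j"
proof -
  have "orbit_rel p a j k \<longleftrightarrow> orbit_rel p a k j" using orbit_sym assms by blast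
  then show ?thesis by (simp add: proj_entry_def q[symmetric] mult_ac)
qed

text \<open>The phases at the intermediate index cancel, and each of the \<open>q\<close> indices in
  the orbit of \<open>j\<close> contributes a \<open>q\<close>-th part of the entry.\<close>

lemma proj_entry_idem:
  assumes j: "j < p - 1" and l: "l < p - 1"
  shows "(\<Sum>i<p - 1. proj_entry p a b j i * proj_entry p a b i l) = proj_entry p a b j l"
proof -
  have "proj_entry p a b j i * proj_entry p a b i l
      = of_bool (orbit_rel p a j i) / of_nat q * proj_entry p a b j l" if "i < p - 1" for i
  proof -
    have "orbit_rel p a i l \<longleftrightarrow> orbit_rel p a j l" if "orbit_rel p a j i"
      using that orbit_sym orbit_trans j by blast
    then have "proj_entry p a b j i * proj_entry p a b i l
      = of_bool (orbit_rel p a j i) / of_nat q * (of_bool (orbit_rel p a j l) / of_nat q) *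
          (root_p p ^ (b * (j + 1)) * cnj (root_p p ^ (b * (l + 1)))) *
          (root_p p ^ (b * (i + 1)) * cnj (root_p p ^ (b * (i + 1))))"
      by (auto simp: proj_entry_def q[symmetric])
    then show ?thesis unfolding root_p_cnj by (simp add: proj_entry_def q[symmetric])
  qed
  then have "(\<Sum>i<p - 1. proj_entry p a b j i * proj_entry p a b i l)
      = (\<Sum>i<p - 1. of_bool (orbit_rel p a j i)) / of_nat q * proj_entry p a b j l"
    by (simp add: sum_distrib_right sum_divide_distrib del: sum_of_bool_eq)
  then show ?thesis
    unfolding sum_orbit[OF j] using q_pos[OF p a q] by simp
qed

lemma proj_entry_diag:
  assumes "j < p - 1"
  shows "proj_entry p a b j j = 1 / of_nat q"
  unfolding proj_entry_def q[symmetric] root_p_cnj using orbit_refl[OF assms] by simp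

text \<open>As the projection is Hermitian and idempotent, the squared norm of the projected column
  is a quadratic form that is linear in the projection. This turns differences of probabilities into
  forms of differences of projections. The prefactor is
  \<open>(p - 1) * q / ((p - 1) * p) = q / p\<close>.\<close>

lemma outcome_prob_rho:
  assumes U: "U \<in> carrier_mat (p - 1) (p - 1)" and k: "k < p - 1" and b: "b < p"
  shows "complex_of_real (outcome_prob p a U b (Rho_outcome k)) =
    of_real (real q / real p) *
      (\<Sum>j<p - 1. \<Sum>l<p - 1. proj_entry p a b j l * (cnj (U $$ (j, k)) * U $$ (l, k)))"
proof -
  define u where "u j = U $$ (j, k)" for j
  define M where "M = rep_average (p - 1) (conj_subgroup p a b) (rho p)"
  have M: "M \<in> carrier_mat (p - 1) (p - 1)" by (simp add: M_def rep_average_def)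
  have Mi: "M $$ (i, l) = proj_entry p a b i l" if "i < p - 1" "l < p - 1" for i l
    unfolding M_def by (rule rep_average_rho_index[OF that b])
  have Mu: "(M *\<^sub>v col U k) $ i = (\<Sum>l<p - 1. proj_entry p a b i l * u l)" if "i < p - 1" for i
    using that M U k Mi by (simp add: scalar_prod_def lessThan_atLeast0 u_def)
  have "complex_of_real (vec_norm2 (M *\<^sub>v col U k))
      = (\<Sum>i<p - 1. cnj (\<Sum>j<p - 1. proj_entry p a b i j * u j) * (\<Sum>l<p - 1. proj_entry p a b i l * u l))"
    using M Mu by (simp add: vec_norm2_def complex_norm_square mult.commute del: of_real_power)
  also have "\<dots> = (\<Sum>i<p - 1. \<Sum>j<p - 1. \<Sum>l<p - 1. proj_entry p a b j i * proj_entry p a b i l * (cnj (u j) * u l))"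
    unfolding cnj_sum sum_product complex_cnj_mult
    by (intro sum.cong refl) (simp add: proj_entry_cnj mult_ac)
  also have "\<dots> = (\<Sum>j<p - 1. \<Sum>l<p - 1. \<Sum>i<p - 1. proj_entry p a b j i * proj_entry p a b i l * (cnj (u j) * u l))"
    by (rule sum_swap3)
  also have "\<dots> = (\<Sum>j<p - 1. \<Sum>l<p - 1. proj_entry p a b j l * (cnj (u j) * u l))"
    by (intro sum.cong refl) (simp only: sum_distrib_right[symmetric] proj_entry_idem lessThan_iff)
  finally have "complex_of_real (vec_norm2 (M *\<^sub>v col U k)) = \<dots>" .
  moreover have "real (p - 1) * real q / (real (p - 1) * real p) = real q / real p"
    using prime_gt_1_nat[OF p] by simp
  ultimately show ?thesis
    using card_conj_subgroup[OF p a q b] order_affine_group[of p]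
    by (simp add: fourier_prob_def M_def u_def)
qed

text \<open>Completeness of the basis turns the sum into the trace of the projection, which is
  \<open>(p - 1) / q\<close> because every diagonal entry is \<open>1 / q\<close>.\<close>

lemma sum_outcome_prob_rho:
  assumes U: "U \<in> carrier_mat (p - 1) (p - 1)"
    and rows: "\<And>i j. i < p - 1 \<Longrightarrow> j < p - 1 \<Longrightarrow>
      (\<Sum>k<p - 1. U $$ (i, k) * cnj (U $$ (j, k))) = of_bool (i = j)" and b: "b < p"
  shows "(\<Sum>k<p - 1. outcome_prob p a U b (Rho_outcome k)) = (real p - 1) / real p"
proof -
  let ?P = "proj_entry p a b"
  have "complex_of_real (\<Sum>k<p - 1. outcome_prob p a U b (Rho_outcome k))
      = of_real (real q / real p) *
        (\<Sum>k<p - 1. \<Sum>j<p - 1. \<Sum>l<p - 1. ?P j l * (cnj (U $$ (j, k)) * U $$ (l, k)))"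
    using outcome_prob_rho[OF U _ b]
    by (simp add: sum_distrib_left del: outcome_prob.simps of_real_divide)
  also have "(\<Sum>k<p - 1. \<Sum>j<p - 1. \<Sum>l<p - 1. ?P j l * (cnj (U $$ (j, k)) * U $$ (l, k)))
      = (\<Sum>j<p - 1. \<Sum>l<p - 1. \<Sum>k<p - 1. ?P j l * (cnj (U $$ (j, k)) * U $$ (l, k)))"
    by (rule sum_swap3)
  also have "\<dots> = (\<Sum>j<p - 1. \<Sum>l<p - 1. if l = j then 1 / of_nat q else 0)"
  proof (intro sum.cong refl)
    fix j l assume "j \<in> {..<p - 1}" "l \<in> {..<p - 1}"
    then have jl: "j < p - 1" "l < p - 1" by auto
    have "(\<Sum>k<p - 1. ?P j l * (cnj (U $$ (j, k)) * U $$ (l, k)))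
        = ?P j l * (\<Sum>k<p - 1. U $$ (l, k) * cnj (U $$ (j, k)))"
      by (simp add: sum_distrib_left mult_ac)
    then show "(\<Sum>k<p - 1. ?P j l * (cnj (U $$ (j, k)) * U $$ (l, k))) = (if l = j then 1 / of_nat q else 0)"
      unfolding rows[OF jl(2,1)] using proj_entry_diag[OF jl(1)] by simp
  qed
  also have "\<dots> = of_nat (p - 1) / of_nat q" by simp
  also have "complex_of_real (real q / real p) * (of_nat (p - 1) / of_nat q) = of_real (real (p - 1) / real p)"
    using q_pos[OF p a q] by simp
  finally show ?thesis using prime_gt_1_nat[OF p] unfolding of_real_eq_iff by (simp add: of_nat_diff)
qed

text \<open>Diagonal phases cancel for every \<open>b\<close>; this supplies the zero diagonal
  demanded by \<open>haar_quadratic_form\<close>.\<close>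

lemma proj_entry_diff_diag: "proj_entry p a b j j - proj_entry p a b' j j = 0"
  unfolding proj_entry_def q[symmetric] root_p_cnj by simp

text \<open>Each of the \<open>p - 1\<close> rows has \<open>q\<close> entries in its orbit, and
  each of these differs by at most \<open>2 / q\<close> in modulus.\<close>

lemma sum_proj_entry_diff:
  "(\<Sum>j<p - 1. \<Sum>l<p - 1. (cmod (proj_entry p a b j l - proj_entry p a b' j l))\<^sup>2) \<le> 4 * real (p - 1) / real q"
proof -
  have le: "(cmod (proj_entry p a b j l - proj_entry p a b' j l))\<^sup>2 \<le> of_bool (orbit_rel p a j l) * (4 / (real q)\<^sup>2)" for j l
  proof -
    have n: "cmod (proj_entry p a c j l) = of_bool (orbit_rel p a j l) / real q" for c
      unfolding proj_entry_def norm_mult norm_divide complex_mod_cnj cmod_root_p_power by (simp add: q)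
    have "cmod (proj_entry p a b j l - proj_entry p a b' j l) \<le> of_bool (orbit_rel p a j l) * (2 / real q)"
      using norm_triangle_ineq4[of "proj_entry p a b j l" "proj_entry p a b' j l"] unfolding n
      by (rule order.trans) (cases "orbit_rel p a j l"; simp)
    then have "(cmod (proj_entry p a b j l - proj_entry p a b' j l))\<^sup>2 \<le> (of_bool (orbit_rel p a j l) * (2 / real q))\<^sup>2"
      by (rule power_mono) simp
    then show ?thesis by (cases "orbit_rel p a j l") (simp_all add: power_divide)
  qed
  have "(\<Sum>j<p - 1. \<Sum>l<p - 1. (cmod (proj_entry p a b j l - proj_entry p a b' j l))\<^sup>2)
      \<le> (\<Sum>j<p - 1. (\<Sum>l<p - 1. of_bool (orbit_rel p a j l)) * (4 / (real q)\<^sup>2))"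
    unfolding sum_distrib_right by (intro sum_mono le)
  also have "\<dots> = (\<Sum>j<p - 1. real q * (4 / (real q)\<^sup>2))"
    by (intro sum.cong refl) (simp only: sum_orbit lessThan_iff)
  also have "\<dots> = 4 * real (p - 1) / real q"
    using q_pos[OF p a q] by (simp add: power2_eq_square)
  finally show ?thesis .
qed

end

section \<open>Distinguishing product distributions\<close>

text \<open>Hybrid argument: the factors are exchanged one at a time. In term \<open>i\<close> the
  earlier factors come from \<open>g\<close>, the later ones from \<open>f\<close>, and position
  \<open>i\<close> carries the difference.\<close>

lemma prod_diff_le:
  fixes f g :: "nat \<Rightarrow> real"
  assumes f: "\<And>i. f i \<ge> 0" and g: "\<And>i. g i \<ge> 0"
  shows "\<bar>(\<Prod>i<m. f i) - (\<Prod>i<m. g i)\<bar>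
    \<le> (\<Sum>i<m. \<Prod>j<m. if j < i then g j else if j = i then \<bar>f j - g j\<bar> else f j)"
proof (induction m)
  case (Suc m)
  let ?h = "\<lambda>i j. if j < i then g j else if j = i then \<bar>f j - g j\<bar> else f j"
  have "(\<Prod>i<Suc m. f i) - (\<Prod>i<Suc m. g i)
      = ((\<Prod>i<m. f i) - (\<Prod>i<m. g i)) * f m + (\<Prod>i<m. g i) * (f m - g m)"
    by (simp add: algebra_simps)
  then have "\<bar>(\<Prod>i<Suc m. f i) - (\<Prod>i<Suc m. g i)\<bar>
      \<le> \<bar>(\<Prod>i<m. f i) - (\<Prod>i<m. g i)\<bar> * f m + (\<Prod>i<m. g i) * \<bar>f m - g m\<bar>"
    using f[of m] g by (simp add: abs_mult prod_nonneg order.trans[OF abs_triangle_ineq])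
  also have "\<dots> \<le> (\<Sum>i<m. \<Prod>j<m. ?h i j) * f m + (\<Prod>i<m. g i) * \<bar>f m - g m\<bar>"
    using Suc f by (intro add_right_mono mult_right_mono) auto
  also have "(\<Sum>i<m. \<Prod>j<m. ?h i j) * f m = (\<Sum>i<m. \<Prod>j<Suc m. ?h i j)"
    by (simp add: sum_distrib_right)
  also have "(\<Prod>i<m. g i) * \<bar>f m - g m\<bar> = (\<Prod>j<Suc m. ?h m j)"
    by simp
  also have "(\<Sum>i<m. \<Prod>j<Suc m. ?h i j) + (\<Prod>j<Suc m. ?h m j) = (\<Sum>i<Suc m. \<Prod>j<Suc m. ?h i j)"
    by (rule sum.lessThan_Suc[symmetric])
  finally show ?case .
qed simp

text \<open>Summed over all sample tuples, each hybrid term becomes a product of sums over \<Omega>: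
  the exchanged position gives the total variation, and every other position has mass at most
  1.\<close>

lemma accept_prob_diff_le:
  assumes fin: "finite \<Omega>"
    and P: "\<And>v. P v \<ge> 0" "sum P \<Omega> \<le> 1" and P': "\<And>v. P' v \<ge> 0" "sum P' \<Omega> \<le> 1"
    and f: "\<And>s. 0 \<le> f s" "\<And>s. f s \<le> 1"
  shows "\<bar>accept_prob \<Omega> P m f - accept_prob \<Omega> P' m f\<bar> \<le> real m * (\<Sum>v\<in>\<Omega>. \<bar>P v - P' v\<bar>)"
proof -
  define X where "X = {..<m} \<rightarrow>\<^sub>E \<Omega>"
  define d where "d = (\<Sum>v\<in>\<Omega>. \<bar>P v - P' v\<bar>)"
  define h where "h i j v = (if j < i then P' v else if j = i then \<bar>P v - P' v\<bar> else P v)" for i j :: nat and v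
  have d: "d \<ge> 0" by (simp add: d_def sum_nonneg)
  have "\<bar>accept_prob \<Omega> P m f - accept_prob \<Omega> P' m f\<bar>
      = \<bar>\<Sum>s\<in>X. ((\<Prod>i<m. P (s i)) - (\<Prod>i<m. P' (s i))) * f s\<bar>"
    unfolding accept_prob_def X_def by (simp add: sum_subtractf left_diff_distrib)
  also have "\<dots> \<le> (\<Sum>s\<in>X. \<bar>((\<Prod>i<m. P (s i)) - (\<Prod>i<m. P' (s i))) * f s\<bar>)"
    by (rule sum_abs)
  also have "\<dots> \<le> (\<Sum>s\<in>X. \<bar>(\<Prod>i<m. P (s i)) - (\<Prod>i<m. P' (s i))\<bar>)"
    using f by (intro sum_mono) (simp add: abs_mult mult_left_le)
  also have "\<dots> \<le> (\<Sum>s\<in>X. \<Sum>i<m. \<Prod>j<m. h i j (s j))"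
    unfolding h_def using P P' by (intro sum_mono prod_diff_le) auto
  also have "\<dots> = (\<Sum>i<m. \<Sum>s\<in>X. \<Prod>j<m. h i j (s j))"
    by (rule sum.swap)
  also have "\<dots> = (\<Sum>i<m. \<Prod>j<m. \<Sum>v\<in>\<Omega>. h i j v)"
    unfolding X_def using fin by (subst prod_sum_PiE) auto
  also have "\<dots> \<le> (\<Sum>i<m. d)"
  proof (rule sum_mono)
    fix i assume i: "i \<in> {..<m}"
    have h: "0 \<le> (\<Sum>v\<in>\<Omega>. h i j v) \<and> (\<Sum>v\<in>\<Omega>. h i j v) \<le> 1" if "j \<noteq> i" for j
      using that P P' by (cases "j < i") (auto simp: h_def sum_nonneg)
    have "(\<Prod>j<m. \<Sum>v\<in>\<Omega>. h i j v) = d * (\<Prod>j\<in>{..<m} - {i}. \<Sum>v\<in>\<Omega>. h i j v)"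
      using i by (subst prod.remove[of _ i]) (auto simp: h_def d_def)
    also have "\<dots> \<le> d * 1"
      using d h by (intro mult_left_mono prod_le_1) auto
    finally show "(\<Prod>j<m. \<Sum>v\<in>\<Omega>. h i j v) \<le> d" by simp
  qed
  finally show ?thesis by (simp add: d_def)
qed

lemma distinguishable_imp_le:
  assumes "finite \<Omega>" "\<And>v. P v \<ge> 0" "sum P \<Omega> \<le> 1" "\<And>v. P' v \<ge> 0" "sum P' \<Omega> \<le> 1"
    and "distinguishable \<Omega> P P' m \<delta>"
  shows "\<delta> \<le> real m * (\<Sum>v\<in>\<Omega>. \<bar>P v - P' v\<bar>)"
proof -
  obtain f where f: "\<And>s. 0 \<le> f s" "\<And>s. f s \<le> 1" and "\<delta> \<le> \<bar>accept_prob \<Omega> P m f - accept_prob \<Omega> P' m f\<bar>"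
    using assms(6) unfolding distinguishable_def by blast
  then show ?thesis using accept_prob_diff_le[where f = f, OF assms(1-5) f, of m] by linarith
qed

section \<open>Total variation between the conjugates\<close>

lemma sum_outcomes:
  assumes "prime p"
  shows "(\<Sum>v\<in>outcomes p. f v) =
    (\<Sum>\<psi>\<in>unit_chars p. f (Char_outcome \<psi>)) + (\<Sum>k<p - 1. f (Rho_outcome k))"
proof -
  have "(\<Sum>v\<in>outcomes p. f v) = (\<Sum>v\<in>Char_outcome ` unit_chars p. f v) + (\<Sum>v\<in>Rho_outcome ` {..<p - 1}. f v)"
    unfolding outcomes_def by (rule sum.union_disjoint) (use assms in \<open>auto simp: finite_unit_chars\<close>)
  then show ?thesis by (simp add: sum.reindex inj_on_def)
qed

lemma finite_outcomes: "prime p \<Longrightarrow> finite (outcomes p)"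
  by (simp add: outcomes_def finite_unit_chars)

lemma outcome_prob_nonneg: "outcome_prob p a U b v \<ge> 0"
  by (cases v) (simp_all add: fourier_prob_def vec_norm2_def sum_nonneg)

text \<open>The large representation has mass \<open>(p - 1) / p\<close> and the characters have at
  most \<open>1 / p\<close>. Mass at most 1 is what the hybrid argument asks for.\<close>

lemma sum_outcome_prob_le_1:
  assumes p: "prime p" and a: "a \<in> {1..<p}" and b: "b < p" and U: "U \<in> unitary_mats (p - 1)"
  shows "(\<Sum>v\<in>outcomes p. outcome_prob p a U b v) \<le> 1"
proof -
  have "(\<Sum>k<p - 1. outcome_prob p a U b (Rho_outcome k)) = (real p - 1) / real p"
    using U by (intro sum_outcome_prob_rho[OF p a refl _ _ b]) (auto simp: unitary_mats_iff)
  moreover have "(real p - 1) / real p + 1 / real p = 1"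
    using p by (simp add: add_divide_distrib[symmetric] prime_gt_0_nat)
  ultimately show ?thesis
    unfolding sum_outcomes[OF p] using sum_outcome_prob_char[OF p a refl b, of U] by linarith
qed

section \<open>Second moment and tail of the total variation\<close>

context
  fixes p a q b b' :: nat and \<mu> :: "complex mat measure"
  assumes p: "prime p" and a: "a \<in> {1..<p}" and q: "q = ord p a"
    and b: "b < p" "b' < p" and haar: "haar_unitary (p - 1) \<mu>"
begin

interpretation prob_space \<mu>
  using haar by (simp add: haar_unitary_def)

private definition diff_form :: "nat \<Rightarrow> complex mat \<Rightarrow> complex" where
  "diff_form k U = (\<Sum>i<p - 1. \<Sum>j<p - 1. (proj_entry p a b i j - proj_entry p a b' i j) *
     (cnj (U $$ (i, k)) * U $$ (j, k)))"

private lemma sum_outcome_prob_diff: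
  assumes U: "U \<in> unitary_mats (p - 1)"
  shows "(\<Sum>v\<in>outcomes p. \<bar>outcome_prob p a U b v - outcome_prob p a U b' v\<bar>)
    = (\<Sum>k<p - 1. real q / real p * cmod (diff_form k U))"
proof -
  have "\<bar>outcome_prob p a U b (Rho_outcome k) - outcome_prob p a U b' (Rho_outcome k)\<bar>
      = real q / real p * cmod (diff_form k U)" if k: "k < p - 1" for k
  proof -
    have c: "U \<in> carrier_mat (p - 1) (p - 1)" using U by (simp add: unitary_mats_def)
    have "complex_of_real (outcome_prob p a U b (Rho_outcome k) - outcome_prob p a U b' (Rho_outcome k))
        = of_real (real q / real p) * diff_form k U"
      unfolding of_real_diff outcome_prob_rho[OF p a q c k b(1)] outcome_prob_rho[OF p a q c k b(2)]
      by (simp add: diff_form_def left_diff_distrib right_diff_distrib sum_subtractf)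
    from arg_cong[OF this, of cmod] show ?thesis
      by (simp only: norm_of_real norm_mult abs_divide abs_of_nat)
  qed
  moreover have "outcome_prob p a U b (Char_outcome \<psi>) = outcome_prob p a U b' (Char_outcome \<psi>)" for \<psi>
    unfolding outcome_prob_char[OF p a q b(1)] outcome_prob_char[OF p a q b(2)] ..
  ultimately show ?thesis
    unfolding sum_outcomes[OF p] by (simp del: outcome_prob.simps)
qed

private lemma diff_form_measurable:
  assumes "k < p - 1"
  shows "diff_form k \<in> borel_measurable \<mu>"
  unfolding diff_form_def using assms
  by (intro borel_measurable_sum borel_measurable_times borel_measurable_const
      haar_measurable_cnj[OF haar] haar_measurable_entry[OF haar]) auto

private lemma norm_diff_form_measurable:
  "k < p - 1 \<Longrightarrow> (\<lambda>U. cmod (diff_form k U)) \<in> borel_measurable \<mu>"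
  using diff_form_measurable[of k] by simp

private lemma diff_form_integrable:
  assumes "k < p - 1"
  shows "integrable \<mu> (\<lambda>U. (cmod (diff_form k U))\<^sup>2)"
proof (rule haar_integrable[OF haar])
  show "(\<lambda>U. (cmod (diff_form k U))\<^sup>2) \<in> borel_measurable \<mu>"
    using diff_form_measurable[OF assms] by simp
  define B where "B = (\<Sum>i<p - 1. \<Sum>j<p - 1. cmod (proj_entry p a b i j - proj_entry p a b' i j))"
  fix U assume U: "U \<in> unitary_mats (p - 1)"
  have "cmod (diff_form k U) \<le> B"
    unfolding diff_form_def B_def
  proof (intro sum_norm_le)
    fix i j assume ij: "i \<in> {..<p - 1}" "j \<in> {..<p - 1}"
    have "cmod (U $$ (i, k)) * cmod (U $$ (j, k)) \<le> 1"
      using ij assms unitary_entry_le_1[OF U] by (intro mult_le_one) auto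
    then show "cmod ((proj_entry p a b i j - proj_entry p a b' i j) * (cnj (U $$ (i, k)) * U $$ (j, k)))
        \<le> cmod (proj_entry p a b i j - proj_entry p a b' i j)"
      by (simp add: norm_mult mult_left_le)
  qed
  then show "norm ((cmod (diff_form k U))\<^sup>2) \<le> B\<^sup>2" by (simp add: power_mono)
qed

private lemma diff_form_moment:
  assumes k: "k < p - 1" and p3: "p > 2"
  shows "(\<integral>U. (cmod (diff_form k U))\<^sup>2 \<partial>\<mu>) \<le> 4 / (real q * (real p - 2))"
proof -
  have "(\<integral>U. (cmod (diff_form k U))\<^sup>2 \<partial>\<mu>)
      \<le> (\<Sum>i<p - 1. \<Sum>j<p - 1. (cmod (proj_entry p a b i j - proj_entry p a b' i j))\<^sup>2) /
        (real (p - 1) * (real (p - 1) - 1))"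
    unfolding diff_form_def
    by (rule haar_quadratic_form[OF haar proj_entry_diff_diag[OF p a q] k])
  also have "\<dots> \<le> 4 * real (p - 1) / real q / (real (p - 1) * (real (p - 1) - 1))"
    using p3 by (intro divide_right_mono sum_proj_entry_diff[OF p a q]) auto
  also have "\<dots> = 4 / (real q * (real p - 2))"
    using p3 by (simp add: of_nat_diff divide_simps)
  finally show ?thesis .
qed

text \<open>Cauchy-Schwarz over the \<open>p - 1\<close> columns reduces the claim to moments of
  single columns, so no independence between columns enters.\<close>

private lemma total_diff_moment:
  assumes p3: "p > 3"
  defines "S \<equiv> \<lambda>U. \<Sum>k<p - 1. real q / real p * cmod (diff_form k U)"
  shows "integrable \<mu> (\<lambda>U. (S U)\<^sup>2)" "(\<integral>U. (S U)\<^sup>2 \<partial>\<mu>) \<le> 8 * real q / real p"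
proof -
  define T where "T U = (\<Sum>k<p - 1. real (p - 1) * (real q / real p)\<^sup>2 * (cmod (diff_form k U))\<^sup>2)" for U
  have le: "(S U)\<^sup>2 \<le> T U" for U
  proof -
    have "(S U)\<^sup>2 \<le> (\<Sum>k<p - 1. (real q / real p * cmod (diff_form k U))\<^sup>2) * real (card {..<p - 1})"
      unfolding S_def by (rule sum_squared_le_sum_of_squares)
    also have "\<dots> = T U"
      by (simp add: T_def sum_distrib_left sum_distrib_right power_mult_distrib power_divide mult_ac)
    finally show ?thesis .
  qed
  have intT: "integrable \<mu> T"
    unfolding T_def by (intro Bochner_Integration.integrable_sum integrable_mult_right diff_form_integrable) auto
  have S_meas: "(\<lambda>U. (S U)\<^sup>2) \<in> borel_measurable \<mu>"
    unfolding S_def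
    by (intro borel_measurable_power borel_measurable_sum borel_measurable_times borel_measurable_const
        norm_diff_form_measurable) auto
  show int: "integrable \<mu> (\<lambda>U. (S U)\<^sup>2)"
    by (rule Bochner_Integration.integrable_bound[OF intT S_meas])
      (use le in \<open>auto intro: order.trans[OF _ abs_ge_self]\<close>)
  have q0: "q > 0" by (rule q_pos[OF p a q])
  have "(\<integral>U. (S U)\<^sup>2 \<partial>\<mu>) \<le> (\<integral>U. T U \<partial>\<mu>)"
    using int intT le by (intro integral_mono) auto
  also have "\<dots> = (\<Sum>k<p - 1. real (p - 1) * (real q / real p)\<^sup>2 * (\<integral>U. (cmod (diff_form k U))\<^sup>2 \<partial>\<mu>))"
    unfolding T_def using diff_form_integrable
    by (subst Bochner_Integration.integral_sum) auto
  \<comment> \<open>From \<open>p > 3\<close> follows that \<open>p - 2\<close> is at least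
    \<open>p / 2\<close>; together with \<open>p - 1 \<le> p\<close> this loosens the bound to the
    clean constant 8.\<close>
  also have "\<dots> \<le> (\<Sum>k<p - 1. real p * (real q / real p)\<^sup>2 * (4 / (real q * (real p / 2))))"
  proof (rule sum_mono)
    fix k assume "k \<in> {..<p - 1}"
    then have "(\<integral>U. (cmod (diff_form k U))\<^sup>2 \<partial>\<mu>) \<le> 4 / (real q * (real p - 2))"
      using diff_form_moment p3 by simp
    also have "\<dots> \<le> 4 / (real q * (real p / 2))"
      using p3 q0 by (intro divide_left_mono mult_left_mono) auto
    finally show "real (p - 1) * (real q / real p)\<^sup>2 * (\<integral>U. (cmod (diff_form k U))\<^sup>2 \<partial>\<mu>)
        \<le> real p * (real q / real p)\<^sup>2 * (4 / (real q * (real p / 2)))"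
      by (intro mult_mono) auto
  qed
  also have "\<dots> \<le> real p * (real p * (real q / real p)\<^sup>2 * (4 / (real q * (real p / 2))))"
    by (simp only: sum_constant card_lessThan, intro mult_right_mono) auto
  also have "\<dots> = 8 * real q / real p"
    using p3 q0 by (simp add: power2_eq_square field_simps)
  finally show "(\<integral>U. (S U)\<^sup>2 \<partial>\<mu>) \<le> 8 * real q / real p" .
qed

text \<open>Chebyshev's inequality about 0: the second moment itself is small, so no mean is
  subtracted.\<close>

lemma total_variation_tail:
  assumes p3: "p > 3" and c: "c > 0"
  shows "measure \<mu> {U \<in> space \<mu>.
      (\<Sum>v\<in>outcomes p. \<bar>outcome_prob p a U b v - outcome_prob p a U b' v\<bar>) < c}
    \<ge> 1 - 8 * real q / real p / c\<^sup>2"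
proof -
  define S where "S = (\<lambda>U. \<Sum>k<p - 1. real q / real p * cmod (diff_form k U))"
  have S_meas: "S \<in> borel_measurable \<mu>"
    unfolding S_def
    by (intro borel_measurable_sum borel_measurable_times borel_measurable_const
        norm_diff_form_measurable) auto
  have nonneg: "S U \<ge> 0" for U by (simp add: S_def sum_nonneg)
  have "measure \<mu> {U \<in> space \<mu>. \<bar>S U\<bar> \<ge> c} \<le> (\<integral>U. (S U)\<^sup>2 \<partial>\<mu>) / c\<^sup>2"
    using S_meas total_diff_moment(1)[OF p3] c unfolding S_def by (rule second_moment_method)
  also have "\<dots> \<le> 8 * real q / real p / c\<^sup>2"
    using total_diff_moment(2)[OF p3] unfolding S_def by (intro divide_right_mono) auto
  finally have "measure \<mu> {U \<in> space \<mu>. c \<le> S U} \<le> 8 * real q / real p / c\<^sup>2"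
    using nonneg by simp
  moreover have "measure \<mu> {U \<in> space \<mu>. S U < c} = 1 - measure \<mu> {U \<in> space \<mu>. c \<le> S U}"
  proof -
    have "{U \<in> space \<mu>. S U < c} = space \<mu> - {U \<in> space \<mu>. c \<le> S U}" by auto
    moreover have "{U \<in> space \<mu>. c \<le> S U} \<in> sets \<mu>" using S_meas by simp
    ultimately show ?thesis using prob_compl by simp
  qed
  moreover have "{U \<in> space \<mu>. (\<Sum>v\<in>outcomes p. \<bar>outcome_prob p a U b v - outcome_prob p a U b' v\<bar>) < c}
      = {U \<in> space \<mu>. S U < c}"
    using sum_outcome_prob_diff by (auto simp: S_def haar_space[OF haar])
  ultimately show ?thesis by simp
qed

end

text \<open>An advantage \<delta> is at most \<open>m\<close> times the total variation. Writing the
  power of \<open>p\<close> as an exponential displays the growth in \<open>ln p\<close>; the bound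
  holds for each \<open>U\<close> separately.\<close>

lemma distinguishable_sample_bound:
  assumes p: "prime p" and a: "a \<in> {1..<p}" and b: "b < p" "b' < p" and U: "U \<in> unitary_mats (p - 1)"
    and tv: "(\<Sum>v\<in>outcomes p. \<bar>outcome_prob p a U b v - outcome_prob p a U b' v\<bar>) < real p powr - \<beta>"
    and dist: "distinguishable (outcomes p) (outcome_prob p a U b) (outcome_prob p a U b') m \<delta>"
  shows "real m \<ge> \<delta> * exp (\<beta> * ln (real p))"
proof -
  have p0: "real p > 0" using p by (simp add: prime_gt_0_nat)
  have "\<delta> \<le> real m * (\<Sum>v\<in>outcomes p. \<bar>outcome_prob p a U b v - outcome_prob p a U b' v\<bar>)"
    using sum_outcome_prob_le_1[OF p a _ U] b
    by (intro distinguishable_imp_le[OF finite_outcomes[OF p] _ _ _ _ dist] outcome_prob_nonneg) auto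
  also have "\<dots> \<le> real m * real p powr - \<beta>"
    using tv by (intro mult_left_mono) auto
  finally have "\<delta> * real p powr \<beta> \<le> real m * real p powr - \<beta> * real p powr \<beta>"
    by (intro mult_right_mono) auto
  also have "\<dots> = real m" using p0 by (simp add: powr_minus)
  finally show ?thesis using p0 by (simp add: powr_def)
qed

theorem theorem6:
  fixes \<epsilon> :: real
  assumes "\<epsilon> > 0"
  shows "\<exists>\<beta>>0. \<forall>\<eta>>0. \<forall>\<^sub>F p :: nat in sequentially. prime p \<longrightarrow>
    (\<forall>a q b b' :: nat. \<forall>\<mu>.
       a \<in> {1..<p} \<longrightarrow> q = ord p a \<longrightarrow> real q < real p powr (1 - \<epsilon>) \<longrightarrow>
       b < p \<longrightarrow> b' < p \<longrightarrow> haar_unitary (p - 1) \<mu> \<longrightarrow>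
       measure \<mu> {U \<in> space \<mu>.
           (\<Sum>v\<in>outcomes p. \<bar>outcome_prob p a U b v - outcome_prob p a U b' v\<bar>) < real p powr - \<beta> \<and>
           (\<forall>(m :: nat) \<delta>. \<delta> > 0 \<longrightarrow>
              distinguishable (outcomes p) (outcome_prob p a U b) (outcome_prob p a U b') m \<delta> \<longrightarrow>
              real m \<ge> \<delta> * exp (\<beta> * ln (real p)))}
         \<ge> 1 - \<eta>)"
proof (intro exI[of _ "\<epsilon> / 4"] conjI allI impI)
  \<comment> \<open>With threshold \<open>p powr - \<beta>\<close> the tail bound is below
    \<open>8 * p powr (2 * \<beta> - \<epsilon>)\<close>, so any \<beta> below
    \<open>\<epsilon> / 2\<close> would do; \<open>\<epsilon> / 4\<close> leaves the exponent
    \<open>- (\<epsilon> / 2)\<close>.\<close>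
  show "\<epsilon> / 4 > 0" using assms by simp
  fix \<eta> :: real assume \<eta>: "\<eta> > 0"
  have "((\<lambda>p. 8 * real p powr - (\<epsilon> / 2)) \<longlongrightarrow> 8 * 0) sequentially"
    using assms by (intro tendsto_mult tendsto_const tendsto_neg_powr filterlim_real_sequentially) auto
  then have "\<forall>\<^sub>F p in sequentially. 8 * real p powr - (\<epsilon> / 2) < \<eta>"
    using \<eta> by (intro order_tendstoD(2)) auto
  then show "\<forall>\<^sub>F p :: nat in sequentially. prime p \<longrightarrow>
    (\<forall>a q b b' :: nat. \<forall>\<mu>.
       a \<in> {1..<p} \<longrightarrow> q = ord p a \<longrightarrow> real q < real p powr (1 - \<epsilon>) \<longrightarrow>
       b < p \<longrightarrow> b' < p \<longrightarrow> haar_unitary (p - 1) \<mu> \<longrightarrow>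
       measure \<mu> {U \<in> space \<mu>.
           (\<Sum>v\<in>outcomes p. \<bar>outcome_prob p a U b v - outcome_prob p a U b' v\<bar>) < real p powr - (\<epsilon> / 4) \<and>
           (\<forall>(m :: nat) \<delta>. \<delta> > 0 \<longrightarrow>
              distinguishable (outcomes p) (outcome_prob p a U b) (outcome_prob p a U b') m \<delta> \<longrightarrow>
              real m \<ge> \<delta> * exp (\<epsilon> / 4 * ln (real p)))}
         \<ge> 1 - \<eta>)"
    using eventually_gt_at_top[of 3]
  proof eventually_elim
    case (elim p)
    show ?case
    proof (intro impI allI)
      fix a q b b' :: nat and \<mu> :: "complex mat measure"
      assume p: "prime p" and a: "a \<in> {1..<p}" and q: "q = ord p a"
        and less: "real q < real p powr (1 - \<epsilon>)"
        and b: "b < p" "b' < p" and haar: "haar_unitary (p - 1) \<mu>"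
      let ?tv = "\<lambda>U. \<Sum>v\<in>outcomes p. \<bar>outcome_prob p a U b v - outcome_prob p a U b' v\<bar>"
      define c where "c = real p powr - (\<epsilon> / 4)"
      have p0: "real p > 0" using elim by simp
      have c: "c > 0" "c\<^sup>2 = real p powr - (\<epsilon> / 2)"
        using p0 by (simp_all add: c_def power2_eq_square powr_add[symmetric])
      have "8 * real q / real p / c\<^sup>2 \<le> 8 * real p powr (1 - \<epsilon>) / real p / c\<^sup>2"
        using less by (intro divide_right_mono) auto
      also have "\<dots> = 8 * (real p powr (1 - \<epsilon>) / real p powr 1 / real p powr - (\<epsilon> / 2))"
        using p0 by (simp add: c(2))
      also have "\<dots> = 8 * real p powr - (\<epsilon> / 2)"
        unfolding powr_diff[symmetric] by (simp add: field_simps)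
      finally have "8 * real q / real p / c\<^sup>2 \<le> \<eta>" using elim by simp
      then have "1 - \<eta> \<le> measure \<mu> {U \<in> space \<mu>. ?tv U < c}"
        using total_variation_tail[OF p a q b haar elim(2) c(1)] by linarith
      \<comment> \<open>For unitary \<open>U\<close> the sample bound follows from the total
        variation bound, so the two events coincide and the added quantifiers raise no question of
        measurability.\<close>
      also have "{U \<in> space \<mu>. ?tv U < c} = {U \<in> space \<mu>. ?tv U < c \<and>
          (\<forall>(m :: nat) \<delta>. \<delta> > 0 \<longrightarrow>
              distinguishable (outcomes p) (outcome_prob p a U b) (outcome_prob p a U b') m \<delta> \<longrightarrow>
              real m \<ge> \<delta> * exp (\<epsilon> / 4 * ln (real p)))}"
        using distinguishable_sample_bound[OF p a b, where \<beta> = "\<epsilon> / 4"]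
        unfolding c_def haar_space[OF haar] by blast
      finally show "measure \<mu> {U \<in> space \<mu>. ?tv U < real p powr - (\<epsilon> / 4) \<and>
          (\<forall>(m :: nat) \<delta>. \<delta> > 0 \<longrightarrow>
              distinguishable (outcomes p) (outcome_prob p a U b) (outcome_prob p a U b') m \<delta> \<longrightarrow>
              real m \<ge> \<delta> * exp (\<epsilon> / 4 * ln (real p)))} \<ge> 1 - \<eta>"
        by (simp only: c_def)
    qed
  qed
qed

end
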